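(* Let $A\in\mathbb{R}^{n\times n}$, $B\in\mathbb{R}^{n\times m}$, let $S\in\mathbb{R}^{r\times r}$ be a full-rank matrix, and let $L_1\in\mathbb{R}^{m\times r}$, $L_2\in\mathbb{R}^{m\times r^2}$. Suppose that the eigenvalues of $A$ are disjoint from the eigenvalues of $S$ and from the eigenvalues of the Kronecker sums $S\oplus_k S$ for every $k\ge 2$. Then the invariance equation $$\frac{\partial \Pi(\omega)}{\partial\omega}\,S\omega = A\,\Pi(\omega) + B\left(L_1\omega + L_2\,\omega^{(2)}\right),\qquad \Pi(0)=0,$$ for a map $\Pi$ from a neighbourhood of $0$ in $\mathbb{R}^r$ to $\mathbb{R}^n$ has a unique analytic solution, and it is given by $$\Pi(\omega)=\Pi_1\omega+\Pi_2\,\omega^{(2)},$$ where $\Pi_1\in\mathbb{R}^{n\times r}$ and $\Pi_2\in\mathbb{R}^{n\times r^2}$ are the constant matrices given as the solutions of the Sylvester equations $$\Pi_1 S - A\Pi_1 = BL_1,\qquad \Pi_2(S\oplus S)-A\Pi_2 = BL_2 .$$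
   Context: $\otimes$ is the Kronecker product. For a vector $\omega\in\mathbb{R}^r$, $\omega^{(2)}=\omega\otimes\omega\in\mathbb{R}^{r^2}$. For $S\in\mathbb{R}^{r\times r}$ and $k\ge 1$, the $k$-th Kronecker sum is the $r^k\times r^k$ matrix $S\oplus_k S=\sum_{j=1}^{k} I_r^{(j-1)}\otimes S\otimes I_r^{(k-j)}$, where $I_r^{(i)}$ denotes the $i$-fold Kronecker power of the identity $I_r$ (with $I_r^{(0)}=1$); thus $S\oplus_1 S=S$ and $S\oplus S:=S\oplus_2 S=S\otimes I_r+I_r\otimes S$. $\partial\Pi/\partial\omega$ denotes the Jacobian matrix of $\Pi$. The invariance equation describes the center manifold $x=\Pi(\omega)$ of the linear system $\dot x=Ax+Bu$ driven by the signal generator $\dot\omega=S\omega$, $u=L_1\omega+L_2\omega^{(2)}$. *)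

theory Defs
  imports "HOL-Analysis.Analysis"
begin

text \<open>
  A \<open>p \<times> q\<close> real matrix has type \<^typ>\<open>real ^ 'q ^ 'p\<close>. The coordinates of the Kronecker product
  of two vectors are indexed by pairs, in the order of the two factors;
  the space of \<open>r\<^sup>2\<close>-dimensional vectors is \<^typ>\<open>real ^ ('r \<times> 'r)\<close>.
\<close>

definition kron_vec :: "real ^ 'a \<Rightarrow> real ^ 'b \<Rightarrow> real ^ ('a \<times> 'b)" where
  "kron_vec v w = (\<chi> p. v $ fst p * w $ snd p)"

definition kron_mat ::
    "real ^ 'a ^ 'b \<Rightarrow> real ^ 'c ^ 'd \<Rightarrow> real ^ ('a \<times> 'c) ^ ('b \<times> 'd)" where
  "kron_mat M N = (\<chi> p q. M $ fst p $ fst q * N $ snd p $ snd q)"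

definition kron_sum :: "real ^ 'r ^ 'r \<Rightarrow> real ^ ('r \<times> 'r) ^ ('r \<times> 'r)" where
  "kron_sum S = kron_mat S (mat 1) + kron_mat (mat 1) S"

text \<open>
  The size of the \<open>k\<close>-th Kronecker sum depends on \<open>k\<close>, so it cannot be a fixed index type.
  An \<open>r\<^sup>k \<times> r\<^sup>k\<close> matrix is therefore a function of two index lists over \<^typ>\<open>'r\<close>, of which only
  the values at lists of length \<open>k\<close> matter. In \<open>kron_list p P Q\<close> the left factor \<open>P\<close> is
  \<open>r\<^sup>p \<times> r\<^sup>p\<close>, so it takes the first \<open>p\<close> entries of each index list and \<open>Q\<close> takes the rest.
\<close>

type_synonym 'r list_mat = "'r list \<Rightarrow> 'r list \<Rightarrow> real"

definition list_mat :: "real ^ 'r ^ 'r \<Rightarrow> 'r list_mat" where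
  "list_mat M xs ys = M $ hd xs $ hd ys"

definition kron_list :: "nat \<Rightarrow> 'r list_mat \<Rightarrow> 'r list_mat \<Rightarrow> 'r list_mat" where
  "kron_list p P Q xs ys = P (take p xs) (take p ys) * Q (drop p xs) (drop p ys)"

fun kron_pow_id :: "nat \<Rightarrow> 'r::finite list_mat" where
  "kron_pow_id 0 = (\<lambda>xs ys. 1)"
| "kron_pow_id (Suc i) = kron_list 1 (list_mat (mat 1)) (kron_pow_id i)"

definition kron_sum_pow :: "nat \<Rightarrow> real ^ 'r::finite ^ 'r \<Rightarrow> 'r list_mat" where
  "kron_sum_pow k S xs ys =
     (\<Sum>j = 1..k. kron_list (j - 1) (kron_pow_id (j - 1))
                    (kron_list 1 (list_mat S) (kron_pow_id (k - j))) xs ys)"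

lemma kron_sum_pow_1: "kron_sum_pow 1 S [i] [j] = S $ i $ j"
  by (simp add: kron_sum_pow_def kron_list_def list_mat_def)

lemma kron_sum_pow_2:
  "kron_sum_pow 2 S [i1, i2] [j1, j2] = kron_sum S $ (i1, i2) $ (j1, j2)"
  by (simp add: kron_sum_pow_def kron_list_def list_mat_def kron_sum_def kron_mat_def
      numeral_2_eq_2 mat_def)

text \<open>Complex eigenvalues of a real square matrix whose rows and columns are indexed by a finite set.\<close>

definition eigenvalues_on :: "'i set \<Rightarrow> ('i \<Rightarrow> 'i \<Rightarrow> real) \<Rightarrow> complex set" where
  "eigenvalues_on I M =
     {l. \<exists>v :: 'i \<Rightarrow> complex. (\<exists>i\<in>I. v i \<noteq> 0) \<and>
           (\<forall>i\<in>I. (\<Sum>j\<in>I. complex_of_real (M i j) * v j) = l * v i)}"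

definition eigenvalues :: "real ^ 'n ^ 'n \<Rightarrow> complex set" where
  "eigenvalues M = eigenvalues_on UNIV (\<lambda>i j. M $ i $ j)"

definition eigenvalues_kron_sum :: "nat \<Rightarrow> real ^ 'r ^ 'r \<Rightarrow> complex set" where
  "eigenvalues_kron_sum k S = eigenvalues_on {xs. length xs = k} (kron_sum_pow k S)"

text \<open>
  Real analyticity in several variables: local expansion into a power series over the
  multi-indices \<open>\<alpha>\<close>, summed unconditionally.
\<close>

definition real_analytic_on :: "(real ^ 'r \<Rightarrow> real ^ 'n) \<Rightarrow> (real ^ 'r) set \<Rightarrow> bool" where
  "real_analytic_on f U \<longleftrightarrow>
     (\<forall>a\<in>U. \<exists>e>0. \<exists>c :: ('r \<Rightarrow> nat) \<Rightarrow> real ^ 'n. \<forall>x\<in>ball a e.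
        ((\<lambda>\<alpha>. (\<Prod>i\<in>UNIV. (x $ i - a $ i) ^ \<alpha> i) *\<^sub>R c \<alpha>) has_sum f x) UNIV)"

definition solves_invariance ::
    "real ^ 'n ^ 'n \<Rightarrow> real ^ 'm ^ 'n \<Rightarrow> real ^ 'r ^ 'r \<Rightarrow> real ^ 'r ^ 'm \<Rightarrow> real ^ ('r \<times> 'r) ^ 'm
      \<Rightarrow> (real ^ 'r) set \<Rightarrow> (real ^ 'r \<Rightarrow> real ^ 'n) \<Rightarrow> bool" where
  "solves_invariance A B S L1 L2 U P \<longleftrightarrow>
     P 0 = 0 \<and>
     (\<forall>\<omega>\<in>U. P differentiable (at \<omega>) \<and>
        jacobian P (at \<omega>) *v (S *v \<omega>) = A *v P \<omega> + B *v (L1 *v \<omega> + L2 *v kron_vec \<omega> \<omega>))"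

end

theory Submission
  imports Defs "HOL-Complex_Analysis.Conformal_Mappings"
    "HOL-Computational_Algebra.Fundamental_Theorem_Algebra"
begin

text \<open>
  The difference \<open>R\<close> of two analytic solutions satisfies \<open>DR(\<omega>) S\<omega> = A R(\<omega>)\<close> and \<open>R 0 = 0\<close>.
  Differentiating its expansion at 0 termwise, every homogeneous part \<open>X \<omega>\<^sup>(\<^sup>k\<^sup>)\<close> satisfies the same
  equation. The derivative of \<open>\<omega>\<^sup>(\<^sup>k\<^sup>)\<close> along \<open>S\<omega>\<close> is \<open>K \<omega>\<^sup>(\<^sup>k\<^sup>)\<close>, where \<open>K\<close> is the \<open>k\<close>-th Kronecker sum, so
  differentiating repeatedly along \<open>S\<omega>\<close> gives \<open>X K\<^sup>t \<omega>\<^sup>(\<^sup>k\<^sup>) = A\<^sup>t X \<omega>\<^sup>(\<^sup>k\<^sup>)\<close> for all \<open>t\<close>. The minimal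
  polynomials of the orbits of \<open>K\<close> and \<open>A\<close> have no common root, hence \<open>X \<omega>\<^sup>(\<^sup>k\<^sup>) = 0\<close>. Thus \<open>R\<close> vanishes
  near 0, and by the identity theorem on the connected component of 0. The same orbit argument makes
  the Sylvester operators injective, hence bijective.
\<close>

section \<open>Orbits of matrices without common eigenvalues\<close>

text \<open>
  Polynomials in a matrix are evaluated on the scalar coordinate sequences of an orbit; this treats
  matrices of all sizes, including those indexed by lists, uniformly.
\<close>

definition shift_act :: "complex poly \<Rightarrow> (nat \<Rightarrow> complex) \<Rightarrow> nat \<Rightarrow> complex" where
  "shift_act p s t = (\<Sum>k\<le>degree p. coeff p k * s (t + k))"

lemma shift_act_ge:
  assumes "degree p \<le> N"
  shows "shift_act p s t = (\<Sum>k\<le>N. coeff p k * s (t + k))"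
  unfolding shift_act_def using assms
  by (intro sum.mono_neutral_left) (auto simp: coeff_eq_0)

lemma shift_act_0 [simp]: "shift_act 0 s t = 0"
  by (simp add: shift_act_def)

lemma shift_act_pCons [simp]: "shift_act (pCons a p) s t = a * s t + shift_act p s (Suc t)"
proof -
  have "shift_act (pCons a p) s t = (\<Sum>k\<le>Suc (degree p). coeff (pCons a p) k * s (t + k))"
    by (rule shift_act_ge) (simp add: degree_pCons_le)
  also have "\<dots> = a * s t + (\<Sum>k\<le>degree p. coeff p k * s (Suc t + k))"
    by (subst sum.atMost_Suc_shift) simp
  finally show ?thesis by (simp add: shift_act_def)
qed

lemma shift_act_add: "shift_act (p + q) s t = shift_act p s t + shift_act q s t"
proof -
  let ?N = "max (degree p) (degree q)"
  have "shift_act (p + q) s t = (\<Sum>k\<le>?N. coeff (p + q) k * s (t + k))"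
    by (rule shift_act_ge) (rule degree_add_le_max)
  then show ?thesis
    by (simp add: shift_act_ge[of p ?N] shift_act_ge[of q ?N] sum.distrib algebra_simps)
qed

lemma shift_act_smult: "shift_act (smult a p) s t = a * shift_act p s t"
  by (induction p arbitrary: t) (auto simp: algebra_simps)

text \<open>\<open>shift_act p\<close> is \<open>p\<close> evaluated at the shift operator on
  sequences, so products of polynomials become compositions.\<close>

lemma shift_act_mult: "shift_act (p * q) s t = shift_act p (shift_act q s) t"
  by (induction p arbitrary: t) (auto simp: shift_act_add shift_act_smult)

lemma shift_act_zero_seq [simp]: "shift_act p (\<lambda>_. 0) t = 0"
  by (simp add: shift_act_def)

lemma shift_act_sum:
  "shift_act p (\<lambda>t. \<Sum>i\<in>I. c i * w t i) t = (\<Sum>i\<in>I. c i * shift_act p (\<lambda>t. w t i) t)"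
  by (induction p arbitrary: t)
     (auto simp: sum.distrib sum_distrib_left algebra_simps)

section \<open>Minimal annihilating polynomials of orbits\<close>

lemma linear_dependence:
  fixes f :: "'k \<Rightarrow> 'i \<Rightarrow> 'a::field"
  assumes "finite I" "finite K" "card I < card K"
  shows "\<exists>c. (\<exists>k\<in>K. c k \<noteq> 0) \<and> (\<forall>i\<in>I. (\<Sum>k\<in>K. c k * f k i) = 0)"
  using assms
proof (induction I arbitrary: K f rule: finite_induct)
  case empty
  then show ?case by (intro exI[of _ "\<lambda>_. 1"]) (auto simp: card_gt_0_iff)
next
  case (insert i I)
  show ?case
  proof (cases "\<forall>k\<in>K. f k i = 0")
    case True
    have "card I < card K" using insert by simp
    from insert.IH[OF insert.prems(1) this, of f] True show ?thesis by auto
  next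
    case False
    then obtain k0 where k0: "k0 \<in> K" "f k0 i \<noteq> 0" by auto
    \<comment> \<open>Gaussian elimination: the pivot \<open>k0\<close> clears coordinate
      \<open>i\<close> from the other vectors, leaving one vector and one coordinate fewer.\<close>
    let ?K = "K - {k0}"
    have "card I < card ?K" using insert k0 by simp
    from insert.IH[OF _ this, of "\<lambda>k j. f k j - f k i / f k0 i * f k0 j"] insert.prems
    obtain c where c: "\<exists>k\<in>?K. c k \<noteq> 0"
      "\<And>j. j \<in> I \<Longrightarrow> (\<Sum>k\<in>?K. c k * (f k j - f k i / f k0 i * f k0 j)) = 0" by auto
    \<comment> \<open>The coefficient of the pivot is solved from equation \<open>i\<close>.\<close>
    define d where "d = (\<lambda>k. if k = k0 then - (\<Sum>k\<in>?K. c k * f k i) / f k0 i else c k)"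
    have d: "(\<Sum>k\<in>K. d k * f k j) = (\<Sum>k\<in>?K. c k * (f k j - f k i / f k0 i * f k0 j))" for j
    proof -
      have "(\<Sum>k\<in>K. d k * f k j) = d k0 * f k0 j + (\<Sum>k\<in>?K. d k * f k j)"
        using insert.prems k0 by (intro sum.remove) auto
      moreover have "(\<Sum>k\<in>?K. d k * f k j) = (\<Sum>k\<in>?K. c k * f k j)"
        by (intro sum.cong) (auto simp: d_def)
      moreover have "d k0 * f k0 j = - (\<Sum>k\<in>?K. c k * (f k i / f k0 i * f k0 j))"
        by (simp add: d_def sum_distrib_right sum_divide_distrib mult.assoc)
      ultimately show ?thesis by (simp add: right_diff_distrib sum_subtractf)
    qed
    have "(\<Sum>k\<in>K. d k * f k j) = 0" if "j \<in> insert i I" for j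
      using that k0 c(2) unfolding d by auto
    moreover have "\<exists>k\<in>K. d k \<noteq> 0" using c(1) by (auto simp: d_def)
    ultimately show ?thesis by blast
  qed
qed

text \<open>Among the nonzero polynomials annihilating all coordinate sequences of the orbit,
  \<open>p\<close> has least degree. Dividing out a root leaves a polynomial that does not
  annihilate the orbit, and its value on the orbit is an eigenvector. Division with remainder gives
  the divisibility.\<close>

lemma minimal_annihilator:
  fixes M :: "'i \<Rightarrow> 'i \<Rightarrow> real" and w :: "nat \<Rightarrow> 'i \<Rightarrow> complex"
  assumes fin: "finite I"
    and w: "\<And>t i. i \<in> I \<Longrightarrow> w (Suc t) i = (\<Sum>j\<in>I. of_real (M i j) * w t j)"
  obtains p where "p \<noteq> 0" "\<And>t i. i \<in> I \<Longrightarrow> shift_act p (\<lambda>t. w t i) t = 0"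
    "\<And>z. poly p z = 0 \<Longrightarrow> z \<in> eigenvalues_on I M"
    "\<And>q. (\<And>t i. i \<in> I \<Longrightarrow> shift_act q (\<lambda>t. w t i) t = 0) \<Longrightarrow> p dvd q"
proof -
  define ann where "ann p \<longleftrightarrow> (\<forall>t. \<forall>i\<in>I. shift_act p (\<lambda>t. w t i) t = 0)" for p
  have step: "shift_act q (\<lambda>t. w t i) (Suc t)
      = (\<Sum>j\<in>I. of_real (M i j) * shift_act q (\<lambda>t. w t j) t)" if "i \<in> I" for q i t
    unfolding shift_act_sum[symmetric] using w[OF that] by (simp add: shift_act_def)
  have "\<exists>p. p \<noteq> 0 \<and> ann p"
  proof -
    \<comment> \<open>The \<open>card I + 1\<close> vectors \<open>w 0, ..., w (card I)\<close> have
      \<open>card I\<close> coordinates, so they are dependent. The relation holds at time 0, and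
      \<open>step\<close> carries it to all later times.\<close>
    obtain c where c: "\<exists>k\<in>{..card I}. c k \<noteq> 0"
      "\<And>i. i \<in> I \<Longrightarrow> (\<Sum>k\<in>{..card I}. c k * w k i) = 0"
      using linear_dependence[OF fin, of "{..card I}" w] by auto
    define p where "p = (\<Sum>k\<le>card I. monom (c k) k)"
    have cp: "coeff p k = (if k \<le> card I then c k else 0)" for k
      unfolding p_def by (auto simp: coeff_sum if_distrib cong: if_cong)
    have deg: "degree p \<le> card I" by (rule degree_le) (auto simp: cp)
    from c(1) have "p \<noteq> 0" by (metis atMost_iff coeff_0 cp)
    moreover have "shift_act p (\<lambda>t. w t i) t = 0" if "i \<in> I" for t i
      using that
    proof (induction t arbitrary: i)
      case 0
      then show ?case using c(2) by (simp add: shift_act_ge[OF deg] cp)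
    next
      case (Suc t)
      then show ?case by (simp add: step)
    qed
    ultimately show ?thesis by (auto simp: ann_def)
  qed
  then obtain p where p: "p \<noteq> 0" "ann p"
    and min: "\<And>q. q \<noteq> 0 \<Longrightarrow> ann q \<Longrightarrow> degree p \<le> degree q"
    using ex_has_least_nat[of "\<lambda>p. p \<noteq> 0 \<and> ann p" _ degree] by blast
  show thesis
  proof
    show "p \<noteq> 0" by fact
    show "shift_act p (\<lambda>t. w t i) t = 0" if "i \<in> I" for t i using p(2) that by (auto simp: ann_def)
    show "z \<in> eigenvalues_on I M" if z: "poly p z = 0" for z
    proof -
      from z obtain q where q: "p = [:- z, 1:] * q" by (auto simp: poly_eq_0_iff_dvd)
      with p(1) have "q \<noteq> 0" by auto
      with q have "degree q < degree p" by (simp add: degree_mult_eq del: mult_pCons_left)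
      with min[OF \<open>q \<noteq> 0\<close>] have "\<not> ann q" by auto
      then obtain t i where ti: "i \<in> I" "shift_act q (\<lambda>t. w t i) t \<noteq> 0" by (auto simp: ann_def)
      \<comment> \<open>As \<open>(X - z) q\<close> annihilates the orbit, the shift multiplies
        \<open>q\<close> applied to the orbit by \<open>z\<close>; by \<open>step\<close> this shift
        is the action of \<open>M\<close>.\<close>
      have "(\<Sum>j\<in>I. of_real (M k j) * shift_act q (\<lambda>t. w t j) t) = z * shift_act q (\<lambda>t. w t k) t"
        if "k \<in> I" for k
      proof -
        have "0 = shift_act p (\<lambda>t. w t k) t" using p(2) that by (auto simp: ann_def)
        also have "\<dots> = - z * shift_act q (\<lambda>t. w t k) t + shift_act q (\<lambda>t. w t k) (Suc t)"
          by (simp only: q shift_act_mult) simp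
        finally show ?thesis using step[OF that, of q t] by (simp add: algebra_simps)
      qed
      with ti show ?thesis
        unfolding eigenvalues_on_def by (intro CollectI exI[of _ "\<lambda>i. shift_act q (\<lambda>t. w t i) t"]) auto
    qed
    show "p dvd q" if q: "\<And>t i. i \<in> I \<Longrightarrow> shift_act q (\<lambda>t. w t i) t = 0" for q
    proof (rule ccontr)
      assume "\<not> p dvd q"
      then have nz: "q mod p \<noteq> 0" by (simp add: dvd_eq_mod_eq_0)
      have "ann (q mod p)"
        unfolding ann_def
      proof (intro allI ballI)
        fix t i assume i: "i \<in> I"
        have "shift_act p (\<lambda>t. w t i) = (\<lambda>_. 0)" using p(2) i by (auto simp: ann_def)
        then have "shift_act (q div p * p) (\<lambda>t. w t i) t = 0"
          by (simp add: shift_act_mult)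
        moreover have "shift_act (q div p * p + q mod p) (\<lambda>t. w t i) t = 0"
          using q[OF i] by simp
        ultimately show "shift_act (q mod p) (\<lambda>t. w t i) t = 0"
          unfolding shift_act_add by simp
      qed
      from min[OF nz this] degree_mod_less[OF p(1), of q] nz show False by auto
    qed
  qed
qed

text \<open>Every annihilator of \<open>w\<close> annihilates its image \<open>z\<close>, so the
  minimal annihilator of \<open>z\<close> divides that of \<open>w\<close>. A root of it would be a
  common eigenvalue; having none, it is a nonzero constant, which forces \<open>z\<close> to
  vanish.\<close>

lemma intertwined_orbit_eq_0:
  fixes M :: "'i \<Rightarrow> 'i \<Rightarrow> real" and N :: "'j \<Rightarrow> 'j \<Rightarrow> real"
    and w :: "nat \<Rightarrow> 'i \<Rightarrow> real" and z :: "nat \<Rightarrow> 'j \<Rightarrow> real"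
  assumes fin: "finite I" "finite J"
    and w: "\<And>t i. i \<in> I \<Longrightarrow> w (Suc t) i = (\<Sum>k\<in>I. M i k * w t k)"
    and z: "\<And>t j. j \<in> J \<Longrightarrow> z (Suc t) j = (\<Sum>k\<in>J. N j k * z t k)"
    and X: "\<And>t j. j \<in> J \<Longrightarrow> z t j = (\<Sum>i\<in>I. X j i * w t i)"
    and disj: "eigenvalues_on J N \<inter> eigenvalues_on I M = {}"
    and j: "j \<in> J"
  shows "z t j = 0"
proof -
  let ?w = "\<lambda>t i. complex_of_real (w t i)" and ?z = "\<lambda>t j. complex_of_real (z t j)"
  obtain p where p: "p \<noteq> 0" "\<And>t i. i \<in> I \<Longrightarrow> shift_act p (\<lambda>t. ?w t i) t = 0"
    "\<And>z. poly p z = 0 \<Longrightarrow> z \<in> eigenvalues_on I M"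
    by (rule minimal_annihilator[OF fin(1), of ?w M]) (auto simp: w)
  obtain q where q: "q \<noteq> 0" "\<And>t j. j \<in> J \<Longrightarrow> shift_act q (\<lambda>t. ?z t j) t = 0"
    "\<And>z. poly q z = 0 \<Longrightarrow> z \<in> eigenvalues_on J N"
    "\<And>q'. (\<And>t i. i \<in> J \<Longrightarrow> shift_act q' (\<lambda>t. ?z t i) t = 0) \<Longrightarrow> q dvd q'"
    by (rule minimal_annihilator[OF fin(2), of ?z N]) (auto simp: z)
  have "q dvd p"
  proof (rule q(4))
    fix t j assume "j \<in> J"
    then have "(\<lambda>t. ?z t j) = (\<lambda>t. \<Sum>i\<in>I. of_real (X j i) * ?w t i)" using X by auto
    then show "shift_act p (\<lambda>t. ?z t j) t = 0" using p(2) by (simp add: shift_act_sum)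
  qed
  have "poly q z \<noteq> 0" for z
    using q(3)[of z] p(3)[of z] disj \<open>q dvd p\<close> by (meson disjoint_iff dvd_trans poly_eq_0_iff_dvd)
  then have "constant (poly q)" using Fundamental_Theorem_Algebra.fundamental_theorem_of_algebra[of q] by auto
  then have "degree q = 0" by (simp add: constant_degree)
  then obtain c where c: "q = [:c:]" using degree_eq_zeroE by auto
  with q(1) q(2)[OF j, of t] show ?thesis by simp
qed

section \<open>Kronecker sums as directional derivatives\<close>

text \<open>
  The coordinates of \<open>\<omega>\<^sup>(\<^sup>k\<^sup>)\<close> are the numbers \<open>word_monomial \<omega> xs\<close> with \<open>length xs = k\<close>.
\<close>

definition word_monomial :: "real ^ 'r \<Rightarrow> 'r list \<Rightarrow> real" where
  "word_monomial w xs = (\<Prod>x\<leftarrow>xs. w $ x)"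

primrec word_derivative :: "real ^ 'r \<Rightarrow> real ^ 'r \<Rightarrow> 'r list \<Rightarrow> real" where
  "word_derivative w h [] = 0"
| "word_derivative w h (x # xs) = h $ x * word_monomial w xs + w $ x * word_derivative w h xs"

lemma word_monomial_simps [simp]:
  "word_monomial w [] = 1"
  "word_monomial w (x # xs) = w $ x * word_monomial w xs"
  by (simp_all add: word_monomial_def)

lemma word_monomial_scaleR: "word_monomial (s *\<^sub>R w) xs = s ^ length xs * word_monomial w xs"
  by (induction xs) auto

lemma has_derivative_word_monomial:
  "((\<lambda>t. word_monomial (w + t *\<^sub>R h) xs) has_real_derivative
     word_derivative (w + t *\<^sub>R h) h xs) (at t within T)"
proof (induction xs)
  case (Cons x xs)
  have "((\<lambda>t. (w $ x + t * h $ x) * word_monomial (w + t *\<^sub>R h) xs) has_real_derivative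
     (0 + 1 * h $ x) * word_monomial (w + t *\<^sub>R h) xs
     + word_derivative (w + t *\<^sub>R h) h xs * (w $ x + t * h $ x)) (at t within T)"
    by (rule derivative_eq_intros Cons.IH refl | simp)+
  then show ?case by (simp add: algebra_simps)
qed simp

lemma abs_word_monomial_le:
  assumes "\<And>i. \<bar>w $ i\<bar> \<le> R"
  shows "\<bar>word_monomial w xs\<bar> \<le> R ^ length xs"
proof (induction xs)
  case (Cons x xs)
  have "0 \<le> R" using assms[of undefined] by linarith
  with Cons assms[of x] show ?case by (simp add: abs_mult mult_mono)
qed simp

text \<open>The product rule gives \<open>length xs\<close> terms, each with one factor bounded by
  \<open>H\<close> and the others by \<open>R\<close>. The extra \<open>R\<close> on the left avoids
  the exponent \<open>length xs - 1\<close>.\<close>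

lemma abs_word_derivative_le:
  assumes w: "\<And>i. \<bar>w $ i\<bar> \<le> R" and h: "\<And>i. \<bar>h $ i\<bar> \<le> H"
  shows "R * \<bar>word_derivative w h xs\<bar> \<le> real (length xs) * H * R ^ length xs"
proof (induction xs)
  case (Cons x xs)
  have "0 \<le> R" "0 \<le> H" using w[of undefined] h[of undefined] by linarith+
  have "R * \<bar>word_derivative w h (x # xs)\<bar>
      \<le> R * (\<bar>h $ x\<bar> * \<bar>word_monomial w xs\<bar> + \<bar>w $ x\<bar> * \<bar>word_derivative w h xs\<bar>)"
    using \<open>0 \<le> R\<close> by (intro mult_left_mono) (auto simp: abs_mult[symmetric])
  also have "\<dots> = R * (\<bar>h $ x\<bar> * \<bar>word_monomial w xs\<bar>) + \<bar>w $ x\<bar> * (R * \<bar>word_derivative w h xs\<bar>)"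
    by (simp add: algebra_simps)
  also have "\<dots> \<le> R * (H * R ^ length xs) + R * (real (length xs) * H * R ^ length xs)"
    using \<open>0 \<le> R\<close> \<open>0 \<le> H\<close>
    by (intro add_mono mult_left_mono[of _ _ R] mult_mono abs_word_monomial_le Cons.IH w h) auto
  finally show ?case by (simp add: algebra_simps)
qed simp

section \<open>Words as indices of the Kronecker sums\<close>

lemma finite_words: "finite {xs :: 'r::finite list. length xs = k}"
  using finite_lists_length_eq[of "UNIV :: 'r set" k] by simp

lemma sum_words_Suc:
  fixes f :: "'r::finite list \<Rightarrow> 'b::comm_monoid_add"
  shows "(\<Sum>ys | length ys = Suc k. f ys) = (\<Sum>y\<in>UNIV. \<Sum>ys | length ys = k. f (y # ys))"
proof -
  have "{ys :: 'r list. length ys = Suc k} = (\<lambda>(y, ys). y # ys) ` (UNIV \<times> {ys. length ys = k})"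
    by (auto simp: length_Suc_conv)
  moreover have "inj_on (\<lambda>(y, ys). y # ys) (UNIV \<times> {ys :: 'r list. length ys = k})"
    by (auto simp: inj_on_def)
  ultimately have "(\<Sum>ys | length ys = Suc k. f ys)
      = sum (f \<circ> (\<lambda>(y, ys). y # ys)) (UNIV \<times> {ys. length ys = k})"
    by (simp only: sum.reindex)
  then show ?thesis by (simp add: sum.cartesian_product comp_def case_prod_unfold)
qed

lemma kron_pow_id_eq:
  "length xs = k \<Longrightarrow> length ys = k \<Longrightarrow> kron_pow_id k xs ys = of_bool (xs = ys)"
proof (induction k arbitrary: xs ys)
  case (Suc k)
  then show ?case
    by (cases xs; cases ys) (simp_all add: kron_list_def list_mat_def mat_def)
qed auto

text \<open>Only the term \<open>j = 1\<close> of the defining sum puts \<open>S\<close> on the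
  first letter. Every other term has an identity factor there, and removing it leaves a term of the
  sum for \<open>k\<close>.\<close>

lemma kron_sum_pow_Suc:
  assumes "length xs = k" "length ys = k"
  shows "kron_sum_pow (Suc k) S (x # xs) (y # ys)
    = S $ x $ y * of_bool (xs = ys) + of_bool (x = y) * kron_sum_pow k S xs ys"
proof -
  have "kron_sum_pow (Suc k) S (x # xs) (y # ys) = S $ x $ y * of_bool (xs = ys)
    + (\<Sum>j = 1..k. kron_list j (kron_pow_id j)
                    (kron_list 1 (list_mat S) (kron_pow_id (k - j))) (x # xs) (y # ys))"
    unfolding kron_sum_pow_def
    by (subst sum.atLeast_Suc_atMost)
       (auto simp: sum.shift_bounds_cl_Suc_ivl kron_list_def list_mat_def kron_pow_id_eq[OF assms]
        simp del: sum.cl_ivl_Suc)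
  also have "(\<Sum>j = 1..k. kron_list j (kron_pow_id j)
        (kron_list 1 (list_mat S) (kron_pow_id (k - j))) (x # xs) (y # ys))
      = (\<Sum>j = 1..k. of_bool (x = y) * kron_list (j - 1) (kron_pow_id (j - 1))
        (kron_list 1 (list_mat S) (kron_pow_id (k - j))) xs ys)"
  proof (intro sum.cong refl)
    fix j assume "j \<in> {1..k}"
    then obtain i where "j = Suc i" by (cases j) auto
    then show "kron_list j (kron_pow_id j)
        (kron_list 1 (list_mat S) (kron_pow_id (k - j))) (x # xs) (y # ys)
      = of_bool (x = y) * kron_list (j - 1) (kron_pow_id (j - 1))
        (kron_list 1 (list_mat S) (kron_pow_id (k - j))) xs ys"
      by (simp add: kron_list_def list_mat_def mat_def)
  qed
  finally show ?thesis by (simp add: kron_sum_pow_def sum_distrib_left)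
qed

lemma kron_sum_pow_0: "kron_sum_pow 0 S xs ys = 0"
  by (simp add: kron_sum_pow_def)

text \<open>Both sides are the product rule: \<open>S\<close> lands on one letter at a time and
  turns its factor into a coordinate of \<open>S *v w\<close>.\<close>

lemma kron_sum_pow_word_monomial:
  "(\<Sum>ys | length ys = length xs. kron_sum_pow (length xs) S xs ys * word_monomial w ys)
    = word_derivative w (S *v w) xs"
proof (induction xs)
  case Nil
  then show ?case by (simp add: kron_sum_pow_0)
next
  case (Cons x xs)
  let ?W = "{ys. length ys = length xs}"
  have "(\<Sum>ys | length ys = length (x # xs).
          kron_sum_pow (length (x # xs)) S (x # xs) ys * word_monomial w ys)
      = (\<Sum>y\<in>UNIV. \<Sum>ys\<in>?W. kron_sum_pow (Suc (length xs)) S (x # xs) (y # ys)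
          * (w $ y * word_monomial w ys))"
    by (simp add: sum_words_Suc)
  also have "\<dots> = (\<Sum>y\<in>UNIV. \<Sum>ys\<in>?W. S $ x $ y * w $ y * (of_bool (xs = ys) * word_monomial w ys)
      + of_bool (x = y) * w $ y * (kron_sum_pow (length xs) S xs ys * word_monomial w ys))"
    by (intro sum.cong refl) (simp add: kron_sum_pow_Suc algebra_simps)
  also have "\<dots> = (\<Sum>y\<in>UNIV. S $ x $ y * w $ y * (\<Sum>ys\<in>?W. of_bool (xs = ys) * word_monomial w ys)
      + of_bool (x = y) * (w $ y * word_derivative w (S *v w) xs))"
    by (simp add: sum.distrib sum_distrib_left Cons.IH[symmetric] mult.assoc)
  also have "(\<Sum>ys\<in>?W. of_bool (xs = ys) * word_monomial w ys) = word_monomial w xs"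
    by (simp add: finite_words of_bool_def if_distrib[of "\<lambda>a. a * _"] cong: if_cong)
  also have "(\<Sum>y\<in>UNIV. S $ x $ y * w $ y * word_monomial w xs
      + of_bool (x = y) * (w $ y * word_derivative w (S *v w) xs))
      = word_derivative w (S *v w) (x # xs)"
  proof -
    have "(\<Sum>y\<in>UNIV. S $ x $ y * w $ y * word_monomial w xs) = (S *v w) $ x * word_monomial w xs"
      by (simp add: matrix_vector_mult_def sum_distrib_right)
    moreover have "(\<Sum>y\<in>UNIV. of_bool (x = y) * (w $ y * word_derivative w (S *v w) xs))
        = w $ x * word_derivative w (S *v w) xs"
      by (simp add: of_bool_def if_distrib[of "\<lambda>a. a * _"] cong: if_cong)
    ultimately show ?thesis by (simp add: sum.distrib)
  qed
  finally show ?case .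
qed

section \<open>Power series indexed by words\<close>

text \<open>Unconditional summation allows regrouping by length, and each length has finitely many
  words.\<close>

lemma has_sum_words_imp_sums:
  fixes F :: "'r::finite list \<Rightarrow> real"
  assumes "(F has_sum s) UNIV"
  shows "(\<lambda>k. \<Sum>xs | length xs = k. F xs) sums s"
proof -
  have inj: "inj_on snd (Sigma UNIV (\<lambda>k. {xs :: 'r list. length xs = k}))"
    by (auto simp: inj_on_def)
  have "snd ` Sigma UNIV (\<lambda>k. {xs :: 'r list. length xs = k}) = UNIV" by force
  with assms has_sum_reindex[OF inj, of F s]
  have "((\<lambda>x. F (snd x)) has_sum s) (Sigma UNIV (\<lambda>k. {xs :: 'r list. length xs = k}))"
    by (simp add: comp_def)
  then have "((\<lambda>k. \<Sum>xs | length xs = k. F xs) has_sum s) UNIV"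
    by (rule has_sum_SigmaD) (simp add: finite_words)
  then show ?thesis by (rule has_sum_imp_sums)
qed

text \<open>Words replace multi-indices so that each degree is linear in the tensor power of
  \<open>y\<close>, on which the Kronecker sums act. \<open>T\<close> need not be determined by
  \<open>g\<close>, since reordering a word keeps its monomial.\<close>

definition has_word_series :: "('r::finite list \<Rightarrow> real) \<Rightarrow> real \<Rightarrow> (real ^ 'r \<Rightarrow> real) \<Rightarrow> bool" where
  "has_word_series T e g \<longleftrightarrow>
     (\<forall>y. norm y < e \<longrightarrow> ((\<lambda>xs. T xs * word_monomial y xs) has_sum g y) UNIV)"

definition homog_part :: "('r::finite list \<Rightarrow> real) \<Rightarrow> nat \<Rightarrow> real ^ 'r \<Rightarrow> real" where
  "homog_part T k y = (\<Sum>xs | length xs = k. T xs * word_monomial y xs)"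

definition homog_derivative ::
    "('r::finite list \<Rightarrow> real) \<Rightarrow> nat \<Rightarrow> real ^ 'r \<Rightarrow> real ^ 'r \<Rightarrow> real" where
  "homog_derivative T k y h = (\<Sum>xs | length xs = k. T xs * word_derivative y h xs)"

lemma word_derivative_scaleR:
  "word_derivative (s *\<^sub>R w) (s *\<^sub>R h) xs = s ^ length xs * word_derivative w h xs"
  by (induction xs) (auto simp: word_monomial_scaleR algebra_simps)

lemma homog_part_scaleR: "homog_part T k (s *\<^sub>R y) = s ^ k * homog_part T k y"
  by (simp add: homog_part_def word_monomial_scaleR sum_distrib_left algebra_simps)

lemma homog_derivative_scaleR:
  "homog_derivative T k (s *\<^sub>R y) (s *\<^sub>R h) = s ^ k * homog_derivative T k y h"
  by (simp add: homog_derivative_def word_derivative_scaleR sum_distrib_left algebra_simps)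

lemma has_derivative_homog_part:
  "((\<lambda>t. homog_part T k (y + t *\<^sub>R h)) has_real_derivative
     homog_derivative T k (y + t *\<^sub>R h) h) (at t within X)"
  unfolding homog_part_def homog_derivative_def
  by (intro DERIV_sum DERIV_cmult has_derivative_word_monomial)

lemma homog_part_sums:
  "has_word_series T e g \<Longrightarrow> norm y < e \<Longrightarrow> (\<lambda>k. homog_part T k y) sums g y"
  unfolding homog_part_def has_word_series_def using has_sum_words_imp_sums by blast

lemma word_monomial_vec: "word_monomial (vec R) xs = R ^ length xs"
  by (induction xs) auto

text \<open>At the constant vector \<open>vec R\<close> all words of length \<open>k\<close> have
  the monomial \<open>R ^ k\<close>, and unconditional summability of reals is absolute.\<close>

lemma summable_word_coefficients:
  assumes "has_word_series T e g" "norm (vec R :: real ^ 'r::finite) < e" "0 \<le> R"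
  shows "summable (\<lambda>k. (\<Sum>xs | length xs = k. \<bar>T (xs :: 'r list)\<bar>) * R ^ k)"
proof -
  have "(\<lambda>xs. T xs * word_monomial (vec R) xs) summable_on UNIV"
    using assms(1,2) unfolding has_word_series_def summable_on_def by blast
  then have "(\<lambda>xs. norm (T xs * word_monomial (vec R) xs)) summable_on UNIV"
    by (rule summable_on_iff_abs_summable_on_real[THEN iffD1])
  then obtain s where "((\<lambda>xs. norm (T xs * word_monomial (vec R) xs)) has_sum s) UNIV"
    unfolding summable_on_def by blast
  note sums_summable[OF has_sum_words_imp_sums[OF this]]
  moreover have "(\<Sum>xs | length xs = k. norm (T xs * word_monomial (vec R) xs))
      = (\<Sum>xs | length xs = k. \<bar>T xs\<bar>) * R ^ k" for k
    unfolding sum_distrib_right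
    using assms(3) by (intro sum.cong) (auto simp: word_monomial_vec abs_mult)
  ultimately show ?thesis by simp
qed

text \<open>Differentiation costs a factor \<open>k\<close> in degree \<open>k\<close>; halving the
  radius pays for it, since \<open>k \<le> 2 ^ k\<close>.\<close>

lemma abs_homog_derivative_le:
  assumes "\<And>i. \<bar>y $ i\<bar> \<le> R / 2" "\<And>i. \<bar>h $ i\<bar> \<le> H" "0 < R"
  shows "\<bar>homog_derivative T k y h\<bar> \<le> (\<Sum>xs | length xs = k. \<bar>T xs\<bar>) * R ^ k * (2 * H / R)"
proof -
  have H: "0 \<le> H" using assms(2)[of undefined] by linarith
  have "\<bar>word_derivative y h xs\<bar> \<le> R ^ k * (2 * H / R)" if "length xs = k" for xs
  proof -
    have "real k \<le> 2 ^ k" by (simp add: of_nat_less_two_power less_imp_le)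
    then have "real k * H * (R / 2) ^ k \<le> 2 ^ k * H * (R / 2) ^ k"
      using H assms(3) by (intro mult_right_mono) auto
    also have "\<dots> = H * R ^ k" by (simp add: power_divide)
    finally have "R / 2 * \<bar>word_derivative y h xs\<bar> \<le> H * R ^ k"
      using abs_word_derivative_le[OF assms(1,2), of xs] unfolding that by linarith
    then show ?thesis using assms(3) by (simp add: field_simps)
  qed
  then have "\<bar>homog_derivative T k y h\<bar> \<le> (\<Sum>xs | length xs = k. \<bar>T xs\<bar> * (R ^ k * (2 * H / R)))"
    unfolding homog_derivative_def
    by (intro order_trans[OF sum_abs] sum_mono, unfold abs_mult, intro mult_left_mono) auto
  then show ?thesis by (simp only: sum_distrib_right mult.assoc)
qed

text \<open>By the Weierstrass test the series of derivatives converges uniformly on a short segment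
  through \<open>y\<close>, so the original series may be differentiated term by term.\<close>

lemma has_word_series_directional_derivative:
  fixes g :: "real ^ 'r::finite \<Rightarrow> real"
  assumes ser: "has_word_series T e g" and "0 < e"
  obtains d where "0 < d" "\<And>y h. norm y < d \<Longrightarrow>
    (\<exists>D. ((\<lambda>t. g (y + t *\<^sub>R h)) has_real_derivative D) (at 0) \<and>
         (\<lambda>k. homog_derivative T k y h) sums D)"
proof
  \<comment> \<open>Bounding the norm by the l1 norm gives
    \<open>norm (vec R) \<le> CARD('r) * R = e / 2\<close>.\<close>
  define R where "R = e / (2 * CARD('r))"
  have "1 \<le> real CARD('r)" by (simp add: Suc_leI)
  then have "1 < real CARD('r) * 2" by linarith
  then have R: "0 < R" "R < e" using \<open>0 < e\<close> by (auto simp: R_def field_simps)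
  have "norm (vec R :: real ^ 'r) \<le> CARD('r) * R"
    using norm_le_l1_cart[of "vec R :: real ^ 'r"] R by simp
  also have "\<dots> < e" using \<open>0 < e\<close> by (simp add: R_def)
  finally have sm: "summable (\<lambda>k. (\<Sum>xs | length xs = k. \<bar>T xs\<bar>) * R ^ k)"
    using summable_word_coefficients[OF ser] R by auto
  show "0 < R / 4" using R by simp
  fix y h :: "real ^ 'r" assume y: "norm y < R / 4"
  \<comment> \<open>With \<open>norm y < R / 4\<close> this keeps the segment within radius
    \<open>R / 2\<close>, also when \<open>h = 0\<close>.\<close>
  define \<delta> where "\<delta> = R / (4 * (1 + norm h))"
  have \<delta>: "0 < \<delta>" "\<delta> * norm h \<le> R / 4"
    using R unfolding \<delta>_def by (auto simp: field_simps add_pos_nonneg)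
  let ?S = "{-\<delta>..\<delta>}"
  have near: "norm (y + t *\<^sub>R h) \<le> R / 2" if "t \<in> ?S" for t
  proof -
    have "norm (y + t *\<^sub>R h) \<le> norm y + \<bar>t\<bar> * norm h" by (metis norm_scaleR norm_triangle_ineq)
    also have "\<bar>t\<bar> * norm h \<le> \<delta> * norm h" using that by (intro mult_right_mono) auto
    finally show ?thesis using y \<delta> by linarith
  qed
  have bnd: "\<bar>homog_derivative T k (y + t *\<^sub>R h) h\<bar>
      \<le> (\<Sum>xs | length xs = k. \<bar>T xs\<bar>) * R ^ k * (2 * norm h / R)" if "t \<in> ?S" for t k
    using near[OF that] R
    by (intro abs_homog_derivative_le component_le_norm_cart order_trans[OF component_le_norm_cart])
  have sm': "summable (\<lambda>k. (\<Sum>xs | length xs = k. \<bar>T xs\<bar>) * R ^ k * (2 * norm h / R))"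
    using sm by (rule summable_mult2)
  let ?D = "\<lambda>t. \<Sum>k. homog_derivative T k (y + t *\<^sub>R h) h"
  have "uniform_limit ?S (\<lambda>n t. \<Sum>k<n. homog_derivative T k (y + t *\<^sub>R h) h) ?D sequentially"
    by (rule Weierstrass_m_test[OF _ sm']) (simp only: real_norm_def bnd)
  moreover have "summable (\<lambda>k. homog_part T k (y + 0 *\<^sub>R h))"
    using homog_part_sums[OF ser, of y] y R by (simp add: sums_iff)
  ultimately have "\<exists>G. \<forall>t\<in>?S. (\<lambda>k. homog_part T k (y + t *\<^sub>R h)) sums G t \<and>
      (G has_real_derivative ?D t) (at t within ?S)"
    using \<delta> by (intro has_field_derivative_series[of ?S _ _ ?D 0])
       (auto intro!: has_derivative_homog_part)
  then obtain G where G: "\<And>t. t \<in> ?S \<Longrightarrow> (\<lambda>k. homog_part T k (y + t *\<^sub>R h)) sums G t"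
    "\<And>t. t \<in> ?S \<Longrightarrow> (G has_real_derivative ?D t) (at t within ?S)"
    by blast
  have gG: "G t = g (y + t *\<^sub>R h)" if "t \<in> ?S" for t
    using G(1)[OF that] homog_part_sums[OF ser, of "y + t *\<^sub>R h"] near[OF that] R
    by (auto intro: sums_unique2)
  have "at 0 within ?S = at 0" using \<delta> by (intro at_within_interior) auto
  with G(2)[of 0] \<delta> have "(G has_real_derivative ?D 0) (at 0)" by auto
  then have "((\<lambda>t. g (y + t *\<^sub>R h)) has_real_derivative ?D 0) (at 0)"
    by (rule has_field_derivative_transform_within_open[where S = "{-\<delta><..<\<delta>}"]) (use \<delta> gG in auto)
  moreover have "summable (\<lambda>k. homog_derivative T k (y + 0 *\<^sub>R h) h)"
  proof (rule summable_comparison_test[OF _ sm'], intro exI allI impI)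
    have "0 \<in> ?S" using \<delta> by simp
    then show "norm (homog_derivative T k (y + 0 *\<^sub>R h) h)
        \<le> (\<Sum>xs | length xs = k. \<bar>T xs\<bar>) * R ^ k * (2 * norm h / R)" for k
      unfolding real_norm_def by (rule bnd)
  qed
  then have "(\<lambda>k. homog_derivative T k y h) sums ?D 0" by (simp add: summable_sums)
  ultimately show "\<exists>D. ((\<lambda>t. g (y + t *\<^sub>R h)) has_real_derivative D) (at 0) \<and>
         (\<lambda>k. homog_derivative T k y h) sums D" by blast
qed

section \<open>Identity theorem for word series\<close>

lemma power_series_eq_0:
  fixes a :: "nat \<Rightarrow> 'a::{real_normed_field,banach}"
  assumes "0 < r" and s: "\<And>z. norm z < r \<Longrightarrow> (\<lambda>k. a k * z ^ k) sums 0"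
  shows "a k = 0"
proof (cases k)
  case 0
  have "(\<lambda>k. a k * 0 ^ k) sums 0" using s[of 0] assms(1) by simp
  then show ?thesis using 0 sums_unique2 powser_sums_zero by blast
next
  case (Suc m)
  show ?thesis
  proof (rule ccontr)
    assume "a k \<noteq> 0"
    \<comment> \<open>A nonzero coefficient of positive index would make the sum, which is 0,
      nonzero on a punctured disc.\<close>
    obtain s where s: "0 < s" and z: "\<And>z. z \<in> cball 0 s - {0 :: 'a} \<Longrightarrow> (0 :: 'a) \<noteq> 0"
      using powser_0_nonzero[of r 0 a "\<lambda>_. 0" k] assms \<open>a k \<noteq> 0\<close> Suc by auto
    have "of_real s \<in> cball 0 s - {0 :: 'a}" using s by auto
    from z[OF this] show False by simp
  qed
qed

text \<open>On the ray through \<open>y\<close>, \<open>g\<close> is a power series in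
  \<open>t\<close> whose coefficients are the homogeneous parts at \<open>y\<close>. It converges
  beyond \<open>t = 1\<close>, and its complexification vanishes at real points accumulating at 1,
  hence identically.\<close>

lemma homog_part_eq_0_radial:
  assumes ser: "has_word_series T e g" and y: "norm y < e"
    and "0 < \<delta>" and z: "\<And>t. \<bar>t - 1\<bar> < \<delta> \<Longrightarrow> g (t *\<^sub>R y) = 0"
  shows "homog_part T k y = 0"
proof -
  obtain r where r: "1 < r" "r * norm y < e"
  proof (cases "y = 0")
    case True
    then show ?thesis using that[of 2] y by auto
  next
    case False
    then obtain r where "1 < r" "r < e / norm y" using dense[of 1 "e / norm y"] y by auto
    then show ?thesis using that False by (simp add: field_simps)
  qed
  have sums: "(\<lambda>k. homog_part T k y * t ^ k) sums g (t *\<^sub>R y)" if "\<bar>t\<bar> < r" for t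
  proof -
    have "\<bar>t\<bar> * norm y \<le> r * norm y" using that by (intro mult_right_mono) auto
    then have "norm (t *\<^sub>R y) < e" using r by simp
    from homog_part_sums[OF ser this] show ?thesis by (simp add: homog_part_scaleR mult.commute)
  qed
  let ?a = "\<lambda>k. complex_of_real (homog_part T k y)"
  define F where "F z = (\<Sum>k. ?a k * z ^ k)" for z
  have F: "(\<lambda>k. ?a k * z ^ k) sums F z" if "norm z < r" for z
  proof -
    obtain x where x: "norm z < x" "x < r" using dense[OF \<open>norm z < r\<close>] by blast
    moreover have "0 < x" using x norm_ge_zero[of z] by linarith
    ultimately have "summable (\<lambda>k. of_real (homog_part T k y * x ^ k) :: complex)"
      by (intro summable_of_real sums_summable[OF sums]) simp
    then have "summable (\<lambda>k. ?a k * of_real x ^ k)" by simp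
    then have "summable (\<lambda>k. ?a k * z ^ k)" by (rule powser_inside) (use x \<open>0 < x\<close> in auto)
    then show ?thesis unfolding F_def by (rule summable_sums)
  qed
  have hol: "F holomorphic_on ball 0 r"
    using F by (intro power_series_holomorphic[of _ _ ?a]) auto
  define \<eta> where "\<eta> = min \<delta> (r - 1)"
  have \<eta>: "0 < \<eta>" using r assms(3) by (simp add: \<eta>_def)
  let ?U = "complex_of_real ` {1<..<1 + \<eta>}"
  have "F z = 0" if "norm z < r" for z
  proof (rule analytic_continuation[OF hol, of ?U 1])
    show "?U \<subseteq> ball 0 r" by (auto simp: \<eta>_def)
    show "1 islimpt ?U"
      unfolding islimpt_approachable
    proof (intro allI impI)
      fix \<epsilon> :: real assume "0 < \<epsilon>"
      define t where "t = 1 + min \<eta> \<epsilon> / 2"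
      have "t \<in> {1<..<1 + \<eta>}" "\<bar>t - 1\<bar> < \<epsilon>" using \<open>0 < \<epsilon>\<close> \<eta> by (auto simp: t_def)
      moreover have "dist (complex_of_real t) 1 = \<bar>t - 1\<bar>"
        by (metis dist_norm norm_of_real of_real_1 of_real_diff)
      ultimately show "\<exists>x'\<in>?U. x' \<noteq> 1 \<and> dist x' 1 < \<epsilon>"
        by (intro bexI[of _ "of_real t"]) auto
    qed
    fix u assume "u \<in> ?U"
    then obtain t where t: "u = of_real t" "1 < t" "t < 1 + \<eta>" by auto
    then have "(\<lambda>k. complex_of_real (homog_part T k y * t ^ k)) sums of_real 0"
      using sums[of t] z[of t] unfolding sums_of_real_iff by (auto simp: \<eta>_def)
    moreover have "norm u < r" using t by (auto simp: \<eta>_def)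
    ultimately show "F u = 0" using F[of u] t(1) by (auto intro: sums_unique2)
  qed (use that r in auto)
  with F have "(\<lambda>k. ?a k * z ^ k) sums 0" if "norm z < r" for z using that by metis
  with r have "?a k = 0" by (intro power_series_eq_0[of r]) auto
  then show ?thesis by simp
qed

text \<open>Along \<open>b + t *\<^sub>R (y - b)\<close> the homogeneous part is a polynomial in
  \<open>t\<close>. It vanishes for all small \<open>t > 0\<close>, hence also at
  \<open>t = 1\<close>.\<close>

lemma homog_part_eq_0_everywhere:
  assumes "0 < \<delta>" and z: "\<And>y. norm (y - b) < \<delta> \<Longrightarrow> homog_part T k y = 0"
  shows "homog_part T k y = 0"
proof -
  define v where "v = y - b"
  define P where "P = (\<Sum>xs | length xs = k. smult (T xs) (\<Prod>x\<leftarrow>xs. [:b $ x, v $ x:]))"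
  have "poly (\<Prod>x\<leftarrow>xs. [:b $ x, v $ x:]) t = word_monomial (b + t *\<^sub>R v) xs" for xs t
    by (induction xs) (simp_all add: algebra_simps)
  then have P: "homog_part T k (b + t *\<^sub>R v) = poly P t" for t
    by (simp add: homog_part_def P_def poly_sum)
  define \<eta> where "\<eta> = \<delta> / (1 + norm v)"
  have \<eta>: "0 < \<eta>" "\<eta> * norm v < \<delta>" using assms(1) by (auto simp: \<eta>_def field_simps add_pos_nonneg)
  have "poly P t = 0" if "t \<in> {0<..<\<eta>}" for t
  proof -
    have "\<bar>t\<bar> * norm v \<le> \<eta> * norm v" using that by (intro mult_right_mono) auto
    then have "norm ((b + t *\<^sub>R v) - b) < \<delta>" using \<eta> by simp
    from z[OF this] P show ?thesis by simp
  qed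
  then have "{0<..<\<eta>} \<subseteq> {t. poly P t = 0}" by auto
  with infinite_Ioo[OF \<eta>(1)] have "\<not> finite {t. poly P t = 0}" using finite_subset by blast
  then have "P = 0" using poly_roots_finite by blast
  with P[of 1] show ?thesis by (simp add: v_def)
qed

text \<open>The expansion at 0 is kept, without re-expanding at \<open>b\<close>: rays show that
  each homogeneous part vanishes near \<open>b\<close>, lines then show that it vanishes
  everywhere.\<close>

lemma has_word_series_identity:
  assumes ser: "has_word_series T e g" and b: "norm b < e" and "0 < \<delta>"
    and z: "\<And>y. norm (y - b) < \<delta> \<Longrightarrow> g y = 0" and y: "norm y < e"
  shows "g y = 0"
proof -
  \<comment> \<open>The first bound leaves \<open>\<delta> / 2\<close> for moving from
    \<open>x\<close> to \<open>t *\<^sub>R x\<close>; the second keeps \<open>x\<close> in the ball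
    of convergence.\<close>
  define \<rho> where "\<rho> = min (\<delta> / 2) (e - norm b)"
  have \<rho>: "0 < \<rho>" using assms by (simp add: \<rho>_def)
  have "homog_part T k x = 0" if x: "norm (x - b) < \<rho>" for k x
  proof (rule homog_part_eq_0_radial[OF ser])
    show "norm x < e" using x norm_triangle_sub[of x b] by (simp add: \<rho>_def)
    show "0 < \<delta> / (2 * (1 + norm x))" using \<open>0 < \<delta>\<close> by (simp add: add_pos_nonneg)
    fix t assume t: "\<bar>t - 1\<bar> < \<delta> / (2 * (1 + norm x))"
    have "norm (t *\<^sub>R x - b) = norm ((t - 1) *\<^sub>R x + (x - b))" by (simp add: algebra_simps)
    also have "\<dots> \<le> \<bar>t - 1\<bar> * norm x + norm (x - b)" by (metis norm_scaleR norm_triangle_ineq)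
    also have "\<bar>t - 1\<bar> * norm x \<le> \<bar>t - 1\<bar> * (1 + norm x)" by (intro mult_left_mono) auto
    also have "\<dots> < \<delta> / 2" using t by (simp add: field_simps add_pos_nonneg)
    finally show "g (t *\<^sub>R x) = 0" using x by (intro z) (simp add: \<rho>_def)
  qed
  then have "homog_part T k y = 0" for k using homog_part_eq_0_everywhere[OF \<rho>] by blast
  then have "(\<lambda>k. 0) sums g y" using homog_part_sums[OF ser y] by simp
  then show ?thesis by (metis sums_unique2 sums_zero)
qed

section \<open>The homogeneous invariance equation\<close>

lemma eigenvalues_on_reindex_subset:
  assumes "bij_betw f I J" "\<And>i j. i \<in> I \<Longrightarrow> j \<in> I \<Longrightarrow> N (f i) (f j) = M i j"
  shows "eigenvalues_on J N \<subseteq> eigenvalues_on I M"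
proof
  fix l assume "l \<in> eigenvalues_on J N"
  then obtain v where v: "\<exists>j\<in>J. v j \<noteq> 0"
    "\<And>i. i \<in> J \<Longrightarrow> (\<Sum>j\<in>J. complex_of_real (N i j) * v j) = l * v i"
    unfolding eigenvalues_on_def by blast
  have J: "J = f ` I" using assms(1) by (simp add: bij_betw_def)
  have "(\<Sum>j\<in>I. complex_of_real (M i j) * v (f j)) = l * v (f i)" if i: "i \<in> I" for i
  proof -
    have "(\<Sum>j\<in>I. complex_of_real (M i j) * v (f j))
        = (\<Sum>j\<in>I. complex_of_real (N (f i) (f j)) * v (f j))"
      using assms(2)[OF i] by (intro sum.cong) auto
    also have "\<dots> = (\<Sum>j\<in>J. complex_of_real (N (f i) j) * v j)"
      by (rule sum.reindex_bij_betw[OF assms(1)])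
    finally show ?thesis using v(2)[of "f i"] i J by simp
  qed
  moreover have "\<exists>i\<in>I. v (f i) \<noteq> 0" using v(1) J by auto
  ultimately show "l \<in> eigenvalues_on I M" unfolding eigenvalues_on_def by auto
qed

lemma eigenvalues_on_reindex:
  assumes f: "bij_betw f I J" and NM: "\<And>i j. i \<in> I \<Longrightarrow> j \<in> I \<Longrightarrow> N (f i) (f j) = M i j"
  shows "eigenvalues_on J N = eigenvalues_on I M"
proof
  show "eigenvalues_on J N \<subseteq> eigenvalues_on I M"
    by (rule eigenvalues_on_reindex_subset[of f]) (use assms in auto)
  show "eigenvalues_on I M \<subseteq> eigenvalues_on J N"
  proof (rule eigenvalues_on_reindex_subset)
    show "bij_betw (inv_into I f) J I" using f by (rule bij_betw_inv_into)
    show "M (inv_into I f i) (inv_into I f j) = N i j" if "i \<in> J" "j \<in> J" for i j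
      using that f NM[of "inv_into I f i" "inv_into I f j"]
      by (auto simp: bij_betw_def inv_into_into f_inv_into_f)
  qed
qed

text \<open>This makes the hypothesis on \<open>S\<close> the case \<open>k = 1\<close> of the
  family of Kronecker sums.\<close>

lemma eigenvalues_kron_sum_1: "eigenvalues_kron_sum 1 S = eigenvalues S"
  unfolding eigenvalues_kron_sum_def eigenvalues_def
proof (rule eigenvalues_on_reindex)
  show "bij_betw (\<lambda>i. [i]) UNIV {xs :: 'a list. length xs = 1}"
    by (auto simp: bij_betw_def inj_on_def length_Suc_conv)
qed (rule kron_sum_pow_1)

text \<open>This carries the hypothesis for \<open>k = 2\<close> to the pair-indexed matrix of the
  second Sylvester equation.\<close>

lemma eigenvalues_kron_sum_2: "eigenvalues_kron_sum 2 S = eigenvalues (kron_sum S)"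
  unfolding eigenvalues_kron_sum_def eigenvalues_def
proof (rule eigenvalues_on_reindex)
  show "bij_betw (\<lambda>p. [fst p, snd p]) UNIV {xs :: 'a list. length xs = 2}"
  proof (rule bij_betwI[where g = "\<lambda>xs. (xs ! 0, xs ! 1)"])
    show "[fst (xs ! 0, xs ! 1), snd (xs ! 0, xs ! 1)] = xs"
      if "xs \<in> {xs :: 'a list. length xs = 2}" for xs
      using that by (intro nth_equalityI) (auto simp: less_Suc_eq)
  qed auto
qed (simp add: kron_sum_pow_2)

text \<open>Coordinate \<open>xs\<close> of \<open>K^m\<close> applied to the tensor power of
  \<open>y\<close>, where \<open>K\<close> is the Kronecker sum of order \<open>length xs\<close>;
  one function serves all degrees.\<close>

primrec kron_orbit :: "real ^ 'r ^ 'r \<Rightarrow> real ^ 'r \<Rightarrow> nat \<Rightarrow> 'r::finite list \<Rightarrow> real" where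
  "kron_orbit S y 0 = word_monomial y"
| "kron_orbit S y (Suc m) = (\<lambda>xs. \<Sum>ys | length ys = length xs.
     kron_sum_pow (length xs) S xs ys * kron_orbit S y m ys)"

text \<open>For \<open>m = 0\<close> this is the product rule; the step is linear because the
  Kronecker sum does not depend on the point.\<close>

lemma has_derivative_kron_orbit:
  "((\<lambda>t. kron_orbit S (y + t *\<^sub>R (S *v y)) m xs) has_real_derivative kron_orbit S y (Suc m) xs) (at 0)"
proof (induction m arbitrary: xs)
  case 0
  then show ?case
    using has_derivative_word_monomial[of y "S *v y" xs 0 UNIV]
    by (simp add: kron_sum_pow_word_monomial)
next
  case (Suc m)
  have "((\<lambda>t. \<Sum>ys | length ys = length xs. kron_sum_pow (length xs) S xs ys *
          kron_orbit S (y + t *\<^sub>R (S *v y)) m ys)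
      has_real_derivative (\<Sum>ys | length ys = length xs. kron_sum_pow (length xs) S xs ys *
          kron_orbit S y (Suc m) ys)) (at 0)"
    by (intro DERIV_sum DERIV_cmult Suc.IH)
  then show ?case by simp
qed

lemma invariant_word_series_eq_0:
  fixes A :: "real ^ 'n ^ 'n" and S :: "real ^ 'r ^ 'r"
    and T :: "'n \<Rightarrow> 'r list \<Rightarrow> real" and g :: "'n \<Rightarrow> real ^ 'r \<Rightarrow> real"
  assumes e: "0 < e" and ser: "\<And>j. has_word_series (T j) e (g j)" and g0: "\<And>j. g j 0 = 0"
    and pde: "\<And>j y. norm y < e \<Longrightarrow>
      ((\<lambda>t. g j (y + t *\<^sub>R (S *v y))) has_real_derivative (\<Sum>l\<in>UNIV. A $ j $ l * g l y)) (at 0)"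
    and disj: "\<And>k. 1 \<le> k \<Longrightarrow> eigenvalues A \<inter> eigenvalues_kron_sum k S = {}"
  obtains d where "0 < d" "\<And>j y. norm y < d \<Longrightarrow> g j y = 0"
proof -
  have "\<exists>d. 0 < d \<and> (\<forall>y h. norm y < d \<longrightarrow>
    (\<exists>D. ((\<lambda>t. g j (y + t *\<^sub>R h)) has_real_derivative D) (at 0) \<and>
         (\<lambda>k. homog_derivative (T j) k y h) sums D))" for j
    by (rule has_word_series_directional_derivative[OF ser[of j] e]) blast
  then obtain d' where d': "\<And>j. 0 < d' j" "\<And>j y h. norm y < d' j \<Longrightarrow>
    \<exists>D. ((\<lambda>t. g j (y + t *\<^sub>R h)) has_real_derivative D) (at 0) \<and>
         (\<lambda>k. homog_derivative (T j) k y h) sums D"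
    by metis
  define d where "d = min e (Min (range d'))"
  have d: "0 < d" "d \<le> e" "\<And>j. d \<le> d' j" using e d'(1) by (auto simp: d_def min.coboundedI2)
  have dsums: "(\<lambda>k. homog_derivative (T j) k y (S *v y)) sums (\<Sum>l\<in>UNIV. A $ j $ l * g l y)"
    if y: "norm y < d" for j y
  proof -
    have "norm y < d' j" "norm y < e" using y d(2) d(3)[of j] by linarith+
    from d'(2)[OF this(1), of "S *v y"] obtain D where
      D: "((\<lambda>t. g j (y + t *\<^sub>R (S *v y))) has_real_derivative D) (at 0)"
        "(\<lambda>k. homog_derivative (T j) k y (S *v y)) sums D" by blast
    from DERIV_unique[OF D(1) pde[OF \<open>norm y < e\<close>]] D(2) show ?thesis by simp
  qed
  have homog: "homog_derivative (T j) k y (S *v y) = (\<Sum>l\<in>UNIV. A $ j $ l * homog_part (T l) k y)"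
    if y: "norm y < d" for j k y
  proof -
    let ?a = "\<lambda>k. homog_derivative (T j) k y (S *v y) - (\<Sum>l\<in>UNIV. A $ j $ l * homog_part (T l) k y)"
    \<comment> \<open>Scaling \<open>y\<close> by \<open>s\<close> multiplies degree
      \<open>k\<close> by \<open>s ^ k\<close> on both sides, so the differences are coefficients of
      a power series in \<open>s\<close> with sum 0.\<close>
    have "(\<lambda>k. ?a k * s ^ k) sums 0" if "norm s < 1" for s
    proof -
      have "\<bar>s\<bar> * norm y \<le> 1 * norm y" using that by (intro mult_right_mono) auto
      then have s: "norm (s *\<^sub>R y) < d" using y by simp
      then have "norm (s *\<^sub>R y) < e" using d(2) by linarith
      then have "(\<lambda>k. \<Sum>l\<in>UNIV. A $ j $ l * homog_part (T l) k (s *\<^sub>R y))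
          sums (\<Sum>l\<in>UNIV. A $ j $ l * g l (s *\<^sub>R y))"
        by (intro sums_sum sums_mult homog_part_sums[OF ser])
      from sums_diff[OF dsums[OF s, of j] this]
      show ?thesis
        by (simp add: matrix_vector_mult_scaleR homog_derivative_scaleR homog_part_scaleR
            sum_distrib_left algebra_simps)
    qed
    from power_series_eq_0[of 1 ?a k, OF _ this] show ?thesis by simp
  qed
  \<comment> \<open>The image of the orbit of the tensor power under the degree \<open>k\<close>
    coefficients; it will turn out to be an orbit of \<open>A\<close>.\<close>
  define z where "z k y m j = (\<Sum>xs | length xs = k. T j xs * kron_orbit S y m xs)" for k y m j
  have z_deriv: "((\<lambda>t. z k (y + t *\<^sub>R (S *v y)) m j) has_real_derivative z k y (Suc m) j) (at 0)"
    for k y m j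
    unfolding z_def by (intro DERIV_sum DERIV_cmult has_derivative_kron_orbit)
  have z_Suc: "z k y (Suc m) j = (\<Sum>l\<in>UNIV. A $ j $ l * z k y m l)" if "norm y < d" for k y m j
    using that
  proof (induction m arbitrary: y j)
    case 0
    have "z k y (Suc 0) j = homog_derivative (T j) k y (S *v y)"
      unfolding z_def homog_derivative_def
      by (intro sum.cong refl) (simp add: kron_sum_pow_word_monomial[symmetric])
    then show ?case using homog[OF 0] by (simp add: z_def homog_part_def)
  next
    case (Suc m)
    \<comment> \<open>The identity for \<open>m\<close> holds at all points near \<open>y\<close>,
      so its two sides have the same derivative along \<open>S *v y\<close>. This is why
      \<open>y\<close> varies in the induction.\<close>
    have d: "((\<lambda>t. \<Sum>l\<in>UNIV. A $ j $ l * z k (y + t *\<^sub>R (S *v y)) m l) has_real_derivative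
        (\<Sum>l\<in>UNIV. A $ j $ l * z k y (Suc m) l)) (at 0)"
      by (intro DERIV_sum DERIV_cmult z_deriv)
    have "\<forall>\<^sub>F t in nhds 0. norm (y + t *\<^sub>R (S *v y)) < d"
    proof -
      have "((\<lambda>t. norm (y + t *\<^sub>R (S *v y))) \<longlongrightarrow> norm (y + 0 *\<^sub>R (S *v y))) (nhds 0)"
        by (intro tendsto_intros filterlim_ident)
      then show ?thesis using Suc.prems by (intro order_tendstoD) auto
    qed
    then have ev: "\<forall>\<^sub>F t in nhds 0. (\<Sum>l\<in>UNIV. A $ j $ l * z k (y + t *\<^sub>R (S *v y)) m l)
        = z k (y + t *\<^sub>R (S *v y)) (Suc m) j"
      by (rule eventually_mono) (simp add: Suc.IH)
    note DERIV_cong_ev[OF refl ev refl, THEN iffD1, OF d]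
    from DERIV_unique[OF z_deriv this] show ?case .
  qed
  have part0: "homog_part (T j) k y = 0" if y: "norm y < d" for j k y
  proof (cases k)
    case 0
    \<comment> \<open>Disjointness is available only from degree 1 on. The constant term is
      \<open>g j 0\<close>, because all other parts vanish at 0.\<close>
    have "homog_part (T j) k 0 = 0" if "k \<noteq> 0" for k
      using homog_part_scaleR[of "T j" k 0 0] that by (simp add: power_0_left)
    then have eq: "(\<lambda>k. homog_part (T j) k 0) = (\<lambda>k. if k = 0 then homog_part (T j) k 0 else 0)"
      by auto
    have "(\<lambda>k. homog_part (T j) k 0) sums homog_part (T j) 0 0"
      by (subst eq) (rule sums_single)
    then have "homog_part (T j) 0 0 = g j 0"
      by (rule sums_unique2) (use homog_part_sums[OF ser] e in simp)
    then have "homog_part (T j) 0 0 = 0" using g0 by simp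
    then show ?thesis using 0 by (simp add: homog_part_def)
  next
    case (Suc i)
    have "z k y 0 j = 0"
    proof (rule intertwined_orbit_eq_0[of "{xs. length xs = k}" UNIV
          "\<lambda>m xs. kron_orbit S y m xs" "kron_sum_pow k S" "z k y" "\<lambda>j l. A $ j $ l" "T"])
      show "eigenvalues_on UNIV (\<lambda>j l. A $ j $ l) \<inter>
          eigenvalues_on {xs. length xs = k} (kron_sum_pow k S) = {}"
        using disj[of k] Suc by (simp add: eigenvalues_def eigenvalues_kron_sum_def)
    qed (auto simp: finite_words z_Suc[OF y] simp del: kron_orbit.simps, auto simp: z_def)
    then show ?thesis by (simp add: z_def homog_part_def)
  qed
  show thesis
  proof
    show "0 < d" by fact
    fix j and y :: "real ^ 'r" assume y: "norm y < d"
    then have "(\<lambda>k. 0) sums g j y" using homog_part_sums[OF ser, of y j] part0 d(2) by simp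
    then show "g j y = 0" by (metis sums_unique2 sums_zero)
  qed
qed

section \<open>Real analytic functions\<close>

lemma word_monomial_eq_prod: "word_monomial y xs = (\<Prod>i\<in>UNIV. y $ i ^ count_list xs i)"
proof (induction xs)
  case (Cons x xs)
  have "(\<Prod>i\<in>UNIV. y $ i ^ count_list (x # xs) i)
      = (\<Prod>i\<in>UNIV. (if i = x then y $ i else 1) * y $ i ^ count_list xs i)"
    by (intro prod.cong) auto
  then show ?case by (simp add: prod.distrib Cons.IH)
qed simp

text \<open>On a finite type every function to \<open>nat\<close> counts a multiset, and every
  multiset comes from a list.\<close>

lemma exists_word_count:
  fixes \<alpha> :: "'r::finite \<Rightarrow> nat"
  shows "\<exists>xs. count_list xs = \<alpha>"
proof -
  obtain xs where "mset xs = Abs_multiset \<alpha>" using ex_mset by blast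
  then have "count (mset xs) = \<alpha>" by (simp add: count_Abs_multiset)
  then show ?thesis by (auto simp: count_mset fun_eq_iff)
qed

lemma real_analytic_on_word_series:
  fixes f :: "real ^ 'r \<Rightarrow> real ^ 'n"
  assumes "real_analytic_on f U" "a \<in> U"
  obtains e T where "0 < e" "\<And>j. has_word_series (T j) e (\<lambda>y. f (a + y) $ j)"
proof -
  obtain e c where e: "0 < e" and c: "\<And>x. x \<in> ball a e \<Longrightarrow>
      ((\<lambda>\<alpha>. (\<Prod>i\<in>UNIV. (x $ i - a $ i) ^ \<alpha> i) *\<^sub>R c \<alpha>) has_sum f x) UNIV"
    using assms unfolding real_analytic_on_def by meson
  obtain rep :: "('r \<Rightarrow> nat) \<Rightarrow> 'r list" where rep: "\<And>\<alpha>. count_list (rep \<alpha>) = \<alpha>"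
    using exists_word_count by metis
  have inj: "inj rep" by (metis injI rep)
  \<comment> \<open>One word is chosen per multi-index, so the coefficient tensor is not symmetric.\<close>
  define T where "T j xs = (if xs \<in> range rep then c (count_list xs) $ j else 0)" for j xs
  show thesis
  proof
    show "0 < e" by fact
    show "has_word_series (T j) e (\<lambda>y. f (a + y) $ j)" for j
      unfolding has_word_series_def
    proof (intro allI impI)
      fix y :: "real ^ 'r" assume "norm y < e"
      then have "a + y \<in> ball a e" by (simp add: dist_norm)
      from has_sum_bounded_linear[OF bounded_linear_vec_nth[of j] c[OF this]]
      have "((\<lambda>\<alpha>. word_monomial y (rep \<alpha>) * c \<alpha> $ j) has_sum f (a + y) $ j) UNIV"
        by (simp add: word_monomial_eq_prod rep)
      then have "((\<lambda>xs. T j xs * word_monomial y xs) has_sum f (a + y) $ j) (range rep)"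
        by (simp add: has_sum_reindex[OF inj] comp_def T_def rep mult.commute)
      then show "((\<lambda>xs. T j xs * word_monomial y xs) has_sum f (a + y) $ j) UNIV"
        by (rule has_sum_cong_neutral[THEN iffD1, rotated -1]) (auto simp: T_def)
    qed
  qed
qed

text \<open>Words with equal letter counts share a monomial, so collecting them gives a series over
  multi-indices with finitely many nonzero terms.\<close>

lemma real_analytic_onI_words:
  fixes f :: "real ^ 'r \<Rightarrow> real ^ 'n"
  assumes "finite L" and f: "\<And>a y. f (a + y) = (\<Sum>xs\<in>L. word_monomial y xs *\<^sub>R T a xs)"
  shows "real_analytic_on f U"
  unfolding real_analytic_on_def
proof (intro ballI exI conjI)
  fix a x assume "a \<in> U" "x \<in> ball a 1"
  let ?c = "\<lambda>\<alpha>. \<Sum>xs | xs \<in> L \<and> count_list xs = \<alpha>. T a xs"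
  let ?m = "\<lambda>\<alpha>. \<Prod>i\<in>UNIV. (x $ i - a $ i) ^ \<alpha> i"
  have "f x = (\<Sum>xs\<in>L. word_monomial (x - a) xs *\<^sub>R T a xs)" using f[of a "x - a"] by simp
  also have "\<dots> = (\<Sum>\<alpha>\<in>count_list ` L.
      \<Sum>xs | xs \<in> L \<and> count_list xs = \<alpha>. word_monomial (x - a) xs *\<^sub>R T a xs)"
    using assms(1) by (rule sum.image_gen)
  also have "\<dots> = (\<Sum>\<alpha>\<in>count_list ` L. ?m \<alpha> *\<^sub>R ?c \<alpha>)"
    by (intro sum.cong refl) (auto simp: scaleR_sum_right word_monomial_eq_prod intro!: sum.cong)
  finally have "((\<lambda>\<alpha>. ?m \<alpha> *\<^sub>R ?c \<alpha>) has_sum f x) (count_list ` L)"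
    using assms(1) by (intro has_sum_finiteI) auto
  then show "((\<lambda>\<alpha>. ?m \<alpha> *\<^sub>R ?c \<alpha>) has_sum f x) UNIV"
  proof (rule has_sum_cong_neutral[THEN iffD1, rotated -1])
    fix \<alpha> assume "\<alpha> \<in> UNIV - count_list ` L"
    then have "{xs. xs \<in> L \<and> count_list xs = \<alpha>} = {}" by auto
    then show "?m \<alpha> *\<^sub>R ?c \<alpha> = 0" by (simp only: sum.empty scaleR_zero_right)
  qed auto
qed simp

section \<open>Identity theorem for real analytic maps\<close>

lemma has_word_series_mono:
  "has_word_series T e g \<Longrightarrow> e' \<le> e \<Longrightarrow> has_word_series T e' g"
  by (auto simp: has_word_series_def)

lemma has_word_series_diff:
  assumes "has_word_series T e g" "has_word_series T' e g'"
  shows "has_word_series (\<lambda>xs. T xs - T' xs) e (\<lambda>y. g y - g' y)"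
  unfolding has_word_series_def
proof (intro allI impI)
  fix y :: "real ^ 'a" assume "norm y < e"
  then have "((\<lambda>xs. T xs * word_monomial y xs) has_sum g y) UNIV"
    "((\<lambda>xs. - (T' xs * word_monomial y xs)) has_sum - g' y) UNIV"
    using assms by (auto simp: has_word_series_def has_sum_uminus)
  from has_sum_add[OF this]
  show "((\<lambda>xs. (T xs - T' xs) * word_monomial y xs) has_sum g y - g' y) UNIV"
    by (simp add: left_diff_distrib)
qed

lemma real_analytic_on_diff_word_series:
  fixes f g :: "real ^ 'r \<Rightarrow> real ^ 'n"
  assumes "real_analytic_on f U" "real_analytic_on g U" "open U" "a \<in> U"
  obtains e T where "0 < e" "ball a e \<subseteq> U"
    "\<And>j. has_word_series (T j) e (\<lambda>y. f (a + y) $ j - g (a + y) $ j)"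
proof -
  obtain e1 T1 where 1: "0 < e1" "\<And>j. has_word_series (T1 j) e1 (\<lambda>y. f (a + y) $ j)"
    using real_analytic_on_word_series[OF assms(1,4)] by blast
  obtain e2 T2 where 2: "0 < e2" "\<And>j. has_word_series (T2 j) e2 (\<lambda>y. g (a + y) $ j)"
    using real_analytic_on_word_series[OF assms(2,4)] by blast
  obtain e3 where 3: "0 < e3" "ball a e3 \<subseteq> U" using assms(3,4) open_contains_ball by blast
  show thesis
  proof
    show "0 < min e1 (min e2 e3)" using 1 2 3 by simp
    show "ball a (min e1 (min e2 e3)) \<subseteq> U" using 3 by auto
    show "has_word_series (\<lambda>xs. T1 j xs - T2 j xs) (min e1 (min e2 e3))
        (\<lambda>y. f (a + y) $ j - g (a + y) $ j)" for j
      by (intro has_word_series_diff has_word_series_mono[OF 1(2)] has_word_series_mono[OF 2(2)]) auto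
  qed
qed

text \<open>Agreement near a point, \<open>Z\<close>, is locally constant: on a ball where the
  difference is a single power series, agreement near any one point spreads to the whole ball.
  Connectedness carries it from \<open>a\<close> to \<open>x\<close>.\<close>

lemma real_analytic_on_identity:
  fixes f g :: "real ^ 'r \<Rightarrow> real ^ 'n"
  assumes f: "real_analytic_on f U" and g: "real_analytic_on g U" and "open U" "a \<in> U"
    and "0 < d" and near: "\<And>x. x \<in> ball a d \<Longrightarrow> f x = g x"
    and x: "x \<in> connected_component_set U a"
  shows "f x = g x"
proof -
  define Z where "Z b \<longleftrightarrow> (\<exists>\<delta>>0. \<forall>x\<in>ball b \<delta>. f x = g x)" for b
  have loc: "\<exists>e>0. (\<forall>c\<in>ball b e. Z c \<longrightarrow> (\<forall>x\<in>ball b e. f x = g x))"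
    if b: "b \<in> U" for b
  proof -
    obtain e T where e: "0 < e" "ball b e \<subseteq> U"
      and ser: "\<And>j. has_word_series (T j) e (\<lambda>y. f (b + y) $ j - g (b + y) $ j)"
      using real_analytic_on_diff_word_series[OF f g \<open>open U\<close> b] by blast
    have "f x = g x" if c: "c \<in> ball b e" "Z c" and x: "x \<in> ball b e" for c x
    proof -
      from c(2) obtain \<delta> where \<delta>: "0 < \<delta>" "\<And>x. x \<in> ball c \<delta> \<Longrightarrow> f x = g x"
        unfolding Z_def by blast
      have "f (b + (x - b)) $ j - g (b + (x - b)) $ j = 0" for j
      proof (rule has_word_series_identity[OF ser[of j] _ \<delta>(1)])
        show "norm (c - b) < e" "norm (x - b) < e"
          using c x by (simp_all add: dist_norm norm_minus_commute)
        fix y assume "norm (y - (c - b)) < \<delta>"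
        then have "b + y \<in> ball c \<delta>" by (simp add: dist_norm norm_minus_commute algebra_simps)
        then show "f (b + y) $ j - g (b + y) $ j = 0" using \<delta>(2) by simp
      qed
      then show ?thesis by (simp add: vec_eq_iff)
    qed
    with e show ?thesis by blast
  qed
  let ?C = "connected_component_set U a"
  have "Z a = Z x"
  proof (rule connected_equivalence_relation[of ?C a x "\<lambda>b c. Z b = Z c"])
    show "connected ?C" by (rule connected_connected_component)
    show "a \<in> ?C" using \<open>a \<in> U\<close> by (simp add: connected_component_refl)
    show "x \<in> ?C" by fact
    fix b assume b: "b \<in> ?C"
    then have "b \<in> U" using connected_component_subset by blast
    then obtain e where e: "0 < e"
      and id: "\<And>c x. c \<in> ball b e \<Longrightarrow> Z c \<Longrightarrow> x \<in> ball b e \<Longrightarrow> f x = g x"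
      using loc by meson
    have ZZ: "Z x" if c: "c \<in> ball b e" "Z c" and x: "x \<in> ball b e" for c x
    proof -
      obtain \<delta> where "0 < \<delta>" "ball x \<delta> \<subseteq> ball b e" using openE[OF open_ball x] by blast
      with id[OF c] show ?thesis unfolding Z_def by blast
    qed
    have "b \<in> ball b e" using e by simp
    then have "\<forall>x\<in>?C \<inter> ball b e. Z b = Z x" using ZZ by blast
    moreover have "openin (top_of_set ?C) (?C \<inter> ball b e)" by (simp add: openin_open_Int)
    ultimately show "\<exists>T. openin (top_of_set ?C) T \<and> b \<in> T \<and> (\<forall>x\<in>T. Z b = Z x)"
      using b \<open>b \<in> ball b e\<close> by blast
  qed auto
  moreover have "Z a" unfolding Z_def using \<open>0 < d\<close> near by blast
  ultimately have "Z x" by simp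
  then show ?thesis unfolding Z_def by (meson centre_in_ball)
qed

section \<open>Sylvester equations and the invariance equation\<close>

lemma matrix_vector_eq_sum_columns:
  fixes M :: "real ^ 'a ^ 'b"
  shows "M *v x = (\<Sum>i\<in>UNIV. x $ i *\<^sub>R (M *v axis i 1))"
  using matrix_mult_sum[of M x] by (simp add: scalar_mult_eq_scaleR matrix_vector_mult_basis)

text \<open>A kernel element satisfies \<open>X ** M = A ** X\<close>, so it maps orbits of
  \<open>M\<close> to orbits of \<open>A\<close> and must vanish. In finite dimension injectivity of
  the operator gives existence as well.\<close>

lemma sylvester_unique:
  fixes A :: "real ^ 'n ^ 'n" and M :: "real ^ 'q ^ 'q" and C :: "real ^ 'q ^ 'n"
  assumes disj: "eigenvalues A \<inter> eigenvalues M = {}"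
  shows "\<exists>X. \<forall>Y. Y ** M - A ** Y = C \<longleftrightarrow> Y = X"
proof -
  let ?L = "\<lambda>X :: real ^ 'q ^ 'n. X ** M - A ** X"
  have lin: "linear ?L"
    by (rule linearI)
       (simp_all add: vec_eq_iff matrix_matrix_mult_def sum.distrib sum_distrib_left algebra_simps)
  have ker: "X = 0" if X: "?L X = 0" for X
  proof -
    have "(X *v axis b 1) $ j = 0" for b j
    proof -
      \<comment> \<open>The orbit of a basis vector: \<open>X *v w 0\<close> is column
        \<open>b\<close> of \<open>X\<close>.\<close>
      define w where "w t = ((*v) M ^^ t) (axis b 1)" for t
      have "(X *v w 0) $ j = 0"
      proof (rule intertwined_orbit_eq_0[of UNIV UNIV "\<lambda>t i. w t $ i" "\<lambda>i k. M $ i $ k"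
            "\<lambda>t j. (X *v w t) $ j" "\<lambda>j k. A $ j $ k" "\<lambda>j i. X $ j $ i"])
        show "(X *v w (Suc t)) $ j = (\<Sum>k\<in>UNIV. A $ j $ k * (X *v w t) $ k)" for t j
        proof -
          have "X *v w (Suc t) = (X ** M) *v w t" by (simp add: w_def matrix_vector_mul_assoc)
          also have "\<dots> = A *v (X *v w t)" using X by (simp add: matrix_vector_mul_assoc)
          finally show ?thesis by (simp add: matrix_vector_mult_def)
        qed
        show "eigenvalues_on UNIV (\<lambda>j k. A $ j $ k) \<inter> eigenvalues_on UNIV (\<lambda>i k. M $ i $ k) = {}"
          using disj by (simp add: eigenvalues_def)
      qed (simp_all add: w_def matrix_vector_mult_def)
      then show ?thesis by (simp add: w_def)
    qed
    then show ?thesis by (simp add: vec_eq_iff matrix_vector_mult_basis column_def)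
  qed
  have inj: "inj ?L" using lin ker linear_injective_0 by blast
  then have "surj ?L" using lin linear_injective_imp_surjective by blast
  then obtain X where "C = ?L X" by (rule surjE)
  with inj show ?thesis by (metis (mono_tags, lifting) injD)
qed

section \<open>The linear-quadratic solution and its uniqueness\<close>

lemma bounded_bilinear_kron_vec:
  "bounded_bilinear (kron_vec :: real ^ 'a \<Rightarrow> real ^ 'b \<Rightarrow> real ^ ('a \<times> 'b))"
  unfolding bilinear_conv_bounded_bilinear[symmetric] bilinear_def
  by (auto intro!: linearI simp: kron_vec_def vec_eq_iff algebra_simps)

interpretation kron_vec: bounded_bilinear kron_vec
  by (rule bounded_bilinear_kron_vec)

text \<open>Each summand of the Kronecker sum acts on one of the two factors, so the right side is
  the derivative of \<open>kron_vec w w\<close> along \<open>S *v w\<close>.\<close>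

lemma kron_sum_kron_vec:
  "kron_sum S *v kron_vec w w = kron_vec w (S *v w) + kron_vec (S *v w) w"
proof -
  have "(kron_sum S *v kron_vec w w) $ (a, b)
      = w $ a * (\<Sum>j\<in>UNIV. S $ b $ j * w $ j) + (\<Sum>i\<in>UNIV. S $ a $ i * w $ i) * w $ b" for a b
  proof -
    have "(kron_sum S *v kron_vec w w) $ (a, b) = (\<Sum>i\<in>UNIV. \<Sum>j\<in>UNIV.
        (if a = i then S $ b $ j * w $ j * w $ i else 0)
        + (if b = j then S $ a $ i * w $ i * w $ j else 0))"
      unfolding UNIV_Times_UNIV[symmetric] matrix_vector_mult_def sum.cartesian_product
      by (auto simp: kron_sum_def kron_mat_def kron_vec_def mat_def algebra_simps intro!: sum.cong)
    also have "\<dots> = (\<Sum>i\<in>UNIV. (if a = i then \<Sum>j\<in>UNIV. S $ b $ j * w $ j * w $ i else 0)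
        + S $ a $ i * w $ i * w $ b)"
      by (intro sum.cong refl) (simp add: sum.distrib)
    finally show ?thesis by (simp add: sum.distrib sum_distrib_left sum_distrib_right mult.commute)
  qed
  then show ?thesis
    by (auto simp: vec_eq_iff kron_vec_def matrix_vector_mult_def)
qed

lemma has_derivative_linear_quadratic:
  fixes P1 :: "real ^ 'r ^ 'n" and P2 :: "real ^ ('r \<times> 'r) ^ 'n"
  shows "((\<lambda>\<omega>. P1 *v \<omega> + P2 *v kron_vec \<omega> \<omega>) has_derivative
    (\<lambda>h. P1 *v h + P2 *v (kron_vec \<omega> h + kron_vec h \<omega>))) (at \<omega>)"
  by (intro has_derivative_add bounded_linear.has_derivative[OF matrix_vector_mul_bounded_linear]
      kron_vec.FDERIV has_derivative_ident)

text \<open>The Taylor expansion at any centre is exact and stops at degree 2, so words of length at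
  most 2 suffice.\<close>

lemma real_analytic_on_linear_quadratic:
  fixes P1 :: "real ^ 'r ^ 'n" and P2 :: "real ^ ('r \<times> 'r) ^ 'n"
  shows "real_analytic_on (\<lambda>\<omega>. P1 *v \<omega> + P2 *v kron_vec \<omega> \<omega>) U"
proof (rule real_analytic_onI_words)
  let ?L = "\<Union>k\<in>{0, 1, 2 :: nat}. {xs :: 'r list. length xs = k}"
  show "finite ?L" using finite_words by blast
  fix a y :: "real ^ 'r"
  let ?P = "\<lambda>\<omega>. P1 *v \<omega> + P2 *v kron_vec \<omega> \<omega>"
  let ?M = "\<lambda>h. P1 *v h + P2 *v (kron_vec a h + kron_vec h a)"
  \<comment> \<open>Taylor coefficients at \<open>a\<close>: the value, the derivative in a basis
    direction, and the quadratic coefficient, which is the same for every \<open>a\<close>.\<close>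
  let ?T = "\<lambda>xs. case xs of [] \<Rightarrow> ?P a | [i] \<Rightarrow> ?M (axis i 1)
    | i # j # _ \<Rightarrow> P2 *v axis (i, j) (1 :: real)"
  have lin: "linear ?M"
    using has_derivative_linear[OF has_derivative_linear_quadratic[of P1 P2 a]] .
  have "y = (\<Sum>i\<in>UNIV. y $ i *\<^sub>R axis i 1)"
    using basis_expansion[of y] by (simp add: scalar_mult_eq_scaleR)
  from arg_cong[OF this, of ?M] have M: "?M y = (\<Sum>i\<in>UNIV. y $ i *\<^sub>R ?M (axis i 1))"
    by (simp only: linear_sum[OF lin] linear_cmul[OF lin])
  have Q: "P2 *v kron_vec y y = (\<Sum>i\<in>UNIV. \<Sum>j\<in>UNIV. (y $ i * y $ j) *\<^sub>R (P2 *v axis (i, j) 1))"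
    unfolding matrix_vector_eq_sum_columns[of P2 "kron_vec y y"] UNIV_Times_UNIV[symmetric]
      sum.cartesian_product
    by (intro sum.cong) (auto simp: kron_vec_def)
  have "?P (a + y) = ?P a + ?M y + P2 *v kron_vec y y"
    by (simp add: kron_vec.add_left kron_vec.add_right matrix_vector_right_distrib algebra_simps)
  also have "\<dots> = (\<Sum>k\<in>{0, 1, 2}. \<Sum>xs | length xs = k. word_monomial y xs *\<^sub>R ?T xs)"
    unfolding M Q by (simp add: numeral_2_eq_2 sum_words_Suc)
  also have "\<dots> = (\<Sum>xs\<in>?L. word_monomial y xs *\<^sub>R ?T xs)"
    by (rule sum.UNION_disjoint[symmetric]) (auto simp: finite_words)
  finally show "?P (a + y) = (\<Sum>xs\<in>?L. word_monomial y xs *\<^sub>R ?T xs)" .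
qed

lemma solves_invariance_linear_quadratic:
  assumes P1: "P1 ** S - A ** P1 = B ** L1" and P2: "P2 ** kron_sum S - A ** P2 = B ** L2"
  shows "solves_invariance A B S L1 L2 U (\<lambda>\<omega>. P1 *v \<omega> + P2 *v kron_vec \<omega> \<omega>)"
proof -
  let ?P = "\<lambda>\<omega>. P1 *v \<omega> + P2 *v kron_vec \<omega> \<omega>"
  have diff: "?P differentiable (at \<omega>)" for \<omega>
    using has_derivative_linear_quadratic by (rule differentiableI)
  have "jacobian ?P (at \<omega>) *v (S *v \<omega>) = A *v ?P \<omega> + B *v (L1 *v \<omega> + L2 *v kron_vec \<omega> \<omega>)" for \<omega>
  proof -
    have "(*v) (jacobian ?P (at \<omega>)) = (\<lambda>h. P1 *v h + P2 *v (kron_vec \<omega> h + kron_vec h \<omega>))"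
      using diff[of \<omega>] has_derivative_linear_quadratic
      unfolding jacobian_works by (rule has_derivative_unique)
    then have "jacobian ?P (at \<omega>) *v (S *v \<omega>) = (P1 ** S) *v \<omega> + (P2 ** kron_sum S) *v kron_vec \<omega> \<omega>"
      by (simp add: kron_sum_kron_vec flip: matrix_vector_mul_assoc)
    also have "P1 ** S = A ** P1 + B ** L1" using P1 by (simp add: algebra_simps)
    also have "P2 ** kron_sum S = A ** P2 + B ** L2" using P2 by (simp add: algebra_simps)
    finally show ?thesis
      by (simp add: matrix_vector_mult_add_rdistrib matrix_vector_right_distrib
          flip: matrix_vector_mul_assoc)
  qed
  with diff show ?thesis by (simp add: solves_invariance_def kron_vec.zero_left)
qed

lemma has_directional_derivative_component:
  fixes f :: "real ^ 'r \<Rightarrow> real ^ 'n"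
  assumes "f differentiable (at y)"
  shows "((\<lambda>t. f (y + t *\<^sub>R v) $ j) has_real_derivative (jacobian f (at y) *v v) $ j) (at 0)"
proof -
  have f: "(f has_derivative (\<lambda>h. jacobian f (at y) *v h)) (at (y + 0 *\<^sub>R v))"
    using assms unfolding jacobian_works by simp
  have "((\<lambda>t. y + t *\<^sub>R v) has_derivative (\<lambda>t. t *\<^sub>R v)) (at 0)"
    by (auto intro!: derivative_eq_intros)
  from has_derivative_compose[OF this f]
  have "((\<lambda>t. f (y + t *\<^sub>R v) $ j) has_derivative (\<lambda>t. (jacobian f (at y) *v (t *\<^sub>R v)) $ j)) (at 0)"
    by (rule bounded_linear.has_derivative[OF bounded_linear_vec_nth])
  then show ?thesis
    unfolding has_field_derivative_def by (simp add: matrix_vector_mult_scaleR mult.commute[of _ "_ $ _"])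
qed

text \<open>The input term is the same for both solutions and cancels in their difference, which
  therefore vanishes near 0; the identity theorem extends this to the component of 0.\<close>

lemma solves_invariance_unique:
  fixes P Q :: "real ^ 'r \<Rightarrow> real ^ 'n"
  assumes U: "open U" "0 \<in> U"
    and P: "real_analytic_on P U" "solves_invariance A B S L1 L2 U P"
    and Q: "real_analytic_on Q U" "solves_invariance A B S L1 L2 U Q"
    and disj: "\<And>k. 1 \<le> k \<Longrightarrow> eigenvalues A \<inter> eigenvalues_kron_sum k S = {}"
    and \<omega>: "\<omega> \<in> connected_component_set U 0"
  shows "Q \<omega> = P \<omega>"
proof -
  obtain e T where e: "0 < e" "ball 0 e \<subseteq> U"
    and ser: "\<And>j. has_word_series (T j) e (\<lambda>y. Q (0 + y) $ j - P (0 + y) $ j)"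
    using real_analytic_on_diff_word_series[OF Q(1) P(1) U] by blast
  let ?g = "\<lambda>j y. Q y $ j - P y $ j"
  have pde: "((\<lambda>t. ?g j (y + t *\<^sub>R (S *v y))) has_real_derivative (\<Sum>l\<in>UNIV. A $ j $ l * ?g l y)) (at 0)"
    if "norm y < e" for j y
  proof -
    have "y \<in> U" using that e(2) by auto
    then have *: "Q differentiable (at y)" "P differentiable (at y)"
      "jacobian Q (at y) *v (S *v y) - jacobian P (at y) *v (S *v y) = A *v Q y - A *v P y"
      using P(2) Q(2) by (auto simp: solves_invariance_def)
    from DERIV_diff[OF *(1,2)[THEN has_directional_derivative_component, of "S *v y" j]]
    show ?thesis
      unfolding vector_minus_component[symmetric] *(3)
      by (simp add: matrix_vector_mult_def sum_subtractf right_diff_distrib)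
  qed
  obtain d where d: "0 < d" "\<And>j y. norm y < d \<Longrightarrow> ?g j y = 0"
  proof (rule invariant_word_series_eq_0[of e T ?g S A])
    show "has_word_series (T j) e (?g j)" for j using ser[of j] by simp
    show "?g j 0 = 0" for j using P(2) Q(2) by (simp add: solves_invariance_def)
  qed (use e(1) pde disj in blast)+
  show ?thesis
  proof (rule real_analytic_on_identity[OF Q(1) P(1) U d(1) _ \<omega>])
    show "Q x = P x" if "x \<in> ball 0 d" for x using d(2)[of x] that by (simp add: vec_eq_iff)
  qed
qed

theorem theorem4p1:
  fixes A :: "real ^ 'n ^ 'n" and B :: "real ^ 'm ^ 'n" and S :: "real ^ 'r ^ 'r"
    and L1 :: "real ^ 'r ^ 'm" and L2 :: "real ^ ('r \<times> 'r) ^ 'm"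
  assumes "rank S = CARD('r)"
    and "eigenvalues A \<inter> eigenvalues S = {}"
    and "\<And>k. k \<ge> 2 \<Longrightarrow> eigenvalues A \<inter> eigenvalues_kron_sum k S = {}"
  shows "\<exists>(P1 :: real ^ 'r ^ 'n) (P2 :: real ^ ('r \<times> 'r) ^ 'n).
      (\<forall>X. X ** S - A ** X = B ** L1 \<longleftrightarrow> X = P1) \<and>
      (\<forall>Y. Y ** kron_sum S - A ** Y = B ** L2 \<longleftrightarrow> Y = P2) \<and>
      (\<forall>U. open U \<and> 0 \<in> U \<longrightarrow>
        (let P = (\<lambda>\<omega>. P1 *v \<omega> + P2 *v kron_vec \<omega> \<omega>) in
          real_analytic_on P U \<and> solves_invariance A B S L1 L2 U P \<and>
          (\<forall>Q. real_analytic_on Q U \<and> solves_invariance A B S L1 L2 U Q \<longrightarrow>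
             (\<forall>\<omega>\<in>connected_component_set U 0. Q \<omega> = P \<omega>))))"
proof -
  have disj: "eigenvalues A \<inter> eigenvalues_kron_sum k S = {}" if "1 \<le> k" for k
    using assms(2) assms(3)[of k] that eigenvalues_kron_sum_1[of S] by (cases "k = 1") auto
  obtain P1 where P1: "\<And>X. X ** S - A ** X = B ** L1 \<longleftrightarrow> X = P1"
    using sylvester_unique[OF assms(2), of "B ** L1"] by blast
  have "eigenvalues A \<inter> eigenvalues (kron_sum S) = {}"
    using disj[of 2] by (simp add: eigenvalues_kron_sum_2)
  from sylvester_unique[OF this, of "B ** L2"]
  obtain P2 where P2: "\<And>Y. Y ** kron_sum S - A ** Y = B ** L2 \<longleftrightarrow> Y = P2" by blast
  define P where "P = (\<lambda>\<omega>. P1 *v \<omega> + P2 *v kron_vec \<omega> \<omega>)"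
  have ana: "real_analytic_on P U" for U
    unfolding P_def by (rule real_analytic_on_linear_quadratic)
  have sol: "solves_invariance A B S L1 L2 U P" for U
    unfolding P_def using P1 P2 by (intro solves_invariance_linear_quadratic) blast+
  have unique: "Q \<omega> = P \<omega>" if "open U \<and> 0 \<in> U"
    "real_analytic_on Q U \<and> solves_invariance A B S L1 L2 U Q"
    "\<omega> \<in> connected_component_set U 0" for U Q \<omega>
    using that by (intro solves_invariance_unique[OF _ _ ana sol _ _ disj]) simp_all
  show ?thesis
    unfolding Let_def
    by (rule exI[of _ P1], rule exI[of _ P2], intro conjI allI impI ballI P1 P2
        ana[unfolded P_def] sol[unfolded P_def], rule unique[unfolded P_def])
qed

end
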